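(* Let $\Omega\subset\mathbb R^n$ be a domain ($n\ge2$), let $\lambda,\mu$ be real constants with $\mu>0$ and $\lambda+2\mu>0$, and let $1<p<\infty$. There is $\varepsilon=\varepsilon(n,\lambda,\mu)>0$ such that the Lamé operator $$\mathcal Lu=\nabla\cdot\left(\lambda(\nabla\cdot u)I+\mu(\nabla u+(\nabla u)^T)\right)$$ is $L^p$-dissipative in $\Omega$ if $$\left(1-\frac2p\right)^2\le1-\left(\frac{\lambda+\mu}{\max\{\mu,\lambda+2\mu\}+\varepsilon}\right)^2 .$$ In dimensions $n\ge3$ the range of $p$ given by this inequality contains the range given by $$\left(1-\frac2p\right)^2\le1-\frac{|\lambda+\mu|}{\max\{\mu,\lambda+2\mu\}} .$$
   Context: $u:\Omega\to\mathbb R^n$. Written as $(\mathcal Lu)_\alpha=\partial_h(A^{hk}_{\alpha\beta}\partial_ku^\beta)$, the Lamé operator has coefficients $A^{hk}_{\alpha\beta}=\mu\,\delta^{hk}\delta_{\alpha\beta}+\lambda\,\delta^h_\alpha\delta^k_\beta+\mu\,\delta^h_\beta\delta^k_\alpha$ ($h,k,\alpha,\beta=1,\dots,n$, summation convention). With $\langle A\xi,\eta\rangle=A^{hk}_{\alpha\beta}\xi^\beta_k\eta^\alpha_h$ and $(\nabla v)^\alpha_h=\partial_hv^\alpha$, $L^p$-dissipativity of $\mathcal L$ in $\Omega$ (in the sense of Cialdea and Maz'ya) means $$\int_\Omega\left\langle A\left(\nabla v-\left(1-\tfrac2p\right)\tfrac{v}{|v|}\nabla|v|\right),\ \nabla v+\left(1-\tfrac2p\right)\tfrac{v}{|v|}\nabla|v|\right\rangle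 dx\ge0\quad\text{for all }v\in W^{1,2}_0(\Omega;\mathbb R^n),$$ where $\frac{v}{|v|}\nabla|v|$ has entries $\frac{v^\alpha}{|v|}\partial_h|v|$ (taken to be $0$ where $v=0$). *)

theory Defs
  imports "HOL-Analysis.Analysis"
begin

definition partial_deriv :: "'n::finite \<Rightarrow> (real ^ 'n \<Rightarrow> real) \<Rightarrow> real ^ 'n \<Rightarrow> real"
  where "partial_deriv h f x = frechet_derivative f (at x) (axis h 1)"

primrec Ck :: "nat \<Rightarrow> (real ^ 'n::finite \<Rightarrow> real) \<Rightarrow> bool"
  where
    "Ck 0 f \<longleftrightarrow> continuous_on UNIV f"
  | "Ck (Suc k) f \<longleftrightarrow> (\<forall>x. f differentiable (at x)) \<and> (\<forall>h. Ck k (partial_deriv h f))"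

definition test_function :: "(real ^ 'n::finite) set \<Rightarrow> (real ^ 'n \<Rightarrow> real) \<Rightarrow> bool"
  where "test_function \<Omega> \<phi> \<longleftrightarrow>
    (\<forall>k. Ck k \<phi>) \<and> compact (closure {x. \<phi> x \<noteq> 0}) \<and> closure {x. \<phi> x \<noteq> 0} \<subseteq> \<Omega>"

definition test_field :: "(real ^ 'n::finite) set \<Rightarrow> (real ^ 'n \<Rightarrow> real ^ 'n) \<Rightarrow> bool"
  where "test_field \<Omega> \<phi> \<longleftrightarrow> (\<forall>\<alpha>. test_function \<Omega> (\<lambda>x. \<phi> x $ \<alpha>))"

definition locally_integrable :: "(real ^ 'n::finite) set \<Rightarrow> (real ^ 'n \<Rightarrow> real) \<Rightarrow> bool"
  where "locally_integrable \<Omega> f \<longleftrightarrow>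
    (\<forall>K. compact K \<and> K \<subseteq> \<Omega> \<longrightarrow> f absolutely_integrable_on K)"

definition is_weak_grad ::
    "(real ^ 'n::finite) set \<Rightarrow> (real ^ 'n \<Rightarrow> real) \<Rightarrow> (real ^ 'n \<Rightarrow> real ^ 'n) \<Rightarrow> bool"
  where "is_weak_grad \<Omega> f g \<longleftrightarrow>
    locally_integrable \<Omega> f \<and> (\<forall>h. locally_integrable \<Omega> (\<lambda>x. g x $ h)) \<and>
    (\<forall>\<phi> h. test_function \<Omega> \<phi> \<longrightarrow>
      (LINT x|lebesgue_on \<Omega>. f x * partial_deriv h \<phi> x) =
      - (LINT x|lebesgue_on \<Omega>. g x $ h * \<phi> x))"

(* Weak gradients are unique up to null sets, so the choice below only matters on a null set;
   it is meaningful only for functions that do have a weak gradient. *)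
definition weak_grad :: "(real ^ 'n::finite) set \<Rightarrow> (real ^ 'n \<Rightarrow> real) \<Rightarrow> real ^ 'n \<Rightarrow> real ^ 'n"
  where "weak_grad \<Omega> f = (SOME g. is_weak_grad \<Omega> f g)"

(* Matrices xi :: real ^ 'n ^ 'n have entries xi $ alpha $ h; here the entry is the weak
   derivative of component alpha in direction h. *)
definition weak_jacobian ::
    "(real ^ 'n::finite) set \<Rightarrow> (real ^ 'n \<Rightarrow> real ^ 'n) \<Rightarrow> real ^ 'n \<Rightarrow> real ^ 'n ^ 'n"
  where "weak_jacobian \<Omega> v x = (\<chi> \<alpha>. weak_grad \<Omega> (\<lambda>y. v y $ \<alpha>) x)"

definition square_integrable ::
    "(real ^ 'n::finite) set \<Rightarrow> (real ^ 'n \<Rightarrow> 'b::euclidean_space) \<Rightarrow> bool"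
  where "square_integrable \<Omega> f \<longleftrightarrow>
    f \<in> borel_measurable (lebesgue_on \<Omega>) \<and> integrable (lebesgue_on \<Omega>) (\<lambda>x. (norm (f x))\<^sup>2)"

definition W12 :: "(real ^ 'n::finite) set \<Rightarrow> (real ^ 'n \<Rightarrow> real ^ 'n) set"
  where "W12 \<Omega> = {v. square_integrable \<Omega> v \<and>
    (\<forall>\<alpha>. \<exists>g. is_weak_grad \<Omega> (\<lambda>y. v y $ \<alpha>) g \<and> square_integrable \<Omega> g)}"

definition W12_norm :: "(real ^ 'n::finite) set \<Rightarrow> (real ^ 'n \<Rightarrow> real ^ 'n) \<Rightarrow> real"
  where "W12_norm \<Omega> v = sqrt ((LINT x|lebesgue_on \<Omega>. (norm (v x))\<^sup>2) +
    (LINT x|lebesgue_on \<Omega>. (norm (weak_jacobian \<Omega> v x))\<^sup>2))"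

definition W12_0 :: "(real ^ 'n::finite) set \<Rightarrow> (real ^ 'n \<Rightarrow> real ^ 'n) set"
  where "W12_0 \<Omega> = {v \<in> W12 \<Omega>. \<forall>e>0. \<exists>\<phi>. test_field \<Omega> \<phi> \<and> W12_norm \<Omega> (\<lambda>x. v x - \<phi> x) < e}"

(* A h k alpha beta stands for the coefficient with upper indices h, k and lower indices
   alpha, beta. *)
definition coeff_form ::
    "('n::finite \<Rightarrow> 'n \<Rightarrow> 'n \<Rightarrow> 'n \<Rightarrow> real) \<Rightarrow> real ^ 'n ^ 'n \<Rightarrow> real ^ 'n ^ 'n \<Rightarrow> real"
  where "coeff_form A \<xi> \<eta> =
    (\<Sum>h\<in>UNIV. \<Sum>k\<in>UNIV. \<Sum>\<alpha>\<in>UNIV. \<Sum>\<beta>\<in>UNIV. A h k \<alpha> \<beta> * \<xi> $ \<beta> $ k * \<eta> $ \<alpha> $ h)"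

(* The matrix (v / |v|) grad |v|; division by zero makes it 0 where v = 0. *)
definition radial_part ::
    "(real ^ 'n::finite) set \<Rightarrow> (real ^ 'n \<Rightarrow> real ^ 'n) \<Rightarrow> real ^ 'n \<Rightarrow> real ^ 'n ^ 'n"
  where "radial_part \<Omega> v x =
    (\<chi> \<alpha> h. v x $ \<alpha> / norm (v x) * weak_grad \<Omega> (\<lambda>y. norm (v y)) x $ h)"

(* For v in W12_0 the function |v| is weakly differentiable with square integrable gradient, so
   the integral is that of an integrable function. *)
definition Lp_dissipative ::
    "(real ^ 'n::finite) set \<Rightarrow> ('n \<Rightarrow> 'n \<Rightarrow> 'n \<Rightarrow> 'n \<Rightarrow> real) \<Rightarrow> real \<Rightarrow> bool"
  where "Lp_dissipative \<Omega> A p \<longleftrightarrow>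
    (\<forall>v \<in> W12_0 \<Omega>.
      0 \<le> (LINT x|lebesgue_on \<Omega>.
             coeff_form A
               (weak_jacobian \<Omega> v x - (1 - 2 / p) *\<^sub>R radial_part \<Omega> v x)
               (weak_jacobian \<Omega> v x + (1 - 2 / p) *\<^sub>R radial_part \<Omega> v x)))"

definition kron :: "'n \<Rightarrow> 'n \<Rightarrow> real"
  where "kron i j = (if i = j then 1 else 0)"

definition lame_coeff :: "real \<Rightarrow> real \<Rightarrow> 'n::finite \<Rightarrow> 'n \<Rightarrow> 'n \<Rightarrow> 'n \<Rightarrow> real"
  where "lame_coeff lam mu h k \<alpha> \<beta> =
    mu * kron h k * kron \<alpha> \<beta> + lam * kron h \<alpha> * kron k \<beta> + mu * kron h \<beta> * kron k \<alpha>"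

(* With xi = grad u this identifies the system with coefficients lame_coeff as the divergence of
   the stress lam (div u) I + mu (grad u + (grad u)^T). *)
lemma lame_coeff_stress:
  fixes \<xi> :: "real ^ 'n::finite ^ 'n"
  shows "(\<Sum>k\<in>UNIV. \<Sum>\<beta>\<in>UNIV. lame_coeff lam mu h k \<alpha> \<beta> * \<xi> $ \<beta> $ k) =
    ((lam * trace \<xi>) *\<^sub>R mat 1 + mu *\<^sub>R (\<xi> + transpose \<xi>)) $ \<alpha> $ h"
proof -
  have K: "(\<Sum>j\<in>UNIV. kron i j * f j) = f i" "(\<Sum>j\<in>UNIV. kron j i * f j) = f i"
    for i :: 'n and f :: "'n \<Rightarrow> real"
    by (simp_all add: kron_def if_distrib[of "\<lambda>c. c * _"] cong: if_cong)
  have "(\<Sum>k\<in>UNIV. \<Sum>\<beta>\<in>UNIV. lame_coeff lam mu h k \<alpha> \<beta> * \<xi> $ \<beta> $ k) =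
    mu * (\<Sum>k\<in>UNIV. kron h k * (\<Sum>\<beta>\<in>UNIV. kron \<alpha> \<beta> * \<xi> $ \<beta> $ k)) +
    lam * kron h \<alpha> * (\<Sum>k\<in>UNIV. \<Sum>\<beta>\<in>UNIV. kron k \<beta> * \<xi> $ \<beta> $ k) +
    mu * (\<Sum>k\<in>UNIV. kron k \<alpha> * (\<Sum>\<beta>\<in>UNIV. kron h \<beta> * \<xi> $ \<beta> $ k))"
    by (simp add: lame_coeff_def sum_distrib_left sum.distrib algebra_simps)
  also have "\<dots> = ((lam * trace \<xi>) *\<^sub>R mat 1 + mu *\<^sub>R (\<xi> + transpose \<xi>)) $ \<alpha> $ h"
    unfolding K by (auto simp: trace_def mat_def transpose_def kron_def distrib_left)
  finally show ?thesis .
qed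

end

theory Submission
  imports Defs
begin

text \<open>
  Write \<open>L = lam + mu\<close>, \<open>N = lam + 2 mu\<close>, \<open>g = 1 - 2 / p\<close>, \<open>w = v /
  |v|\<close>, and let \<open>X\<close> be the weak Jacobian of \<open>v\<close>. The proof has an analytic half,
  which replaces the integrand by a quadratic form in \<open>X\<close>, and an algebraic half, which shows that this
  form is nonnegative at every point.

  The weak gradient of \<open>|v|\<close> is \<open>b = X\<^sup>T w\<close> almost everywhere
  (\<open>W12_0_norm_weak_grad\<close>), so the radial part is the rank one matrix with entries
  \<open>w\<^sub>\<alpha> b\<^sub>h\<close> and the integrand is \<open>mu |X|\<^sup>2 + lam (tr X)\<^sup>2 + mu tr
  (X\<^sup>2) - g\<^sup>2 (mu |b|\<^sup>2 + L (w \<bullet> X w)\<^sup>2)\<close>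
  (\<open>coeff_form_lame_radial\<close>). For \<open>g \<noteq> 0\<close> this form is negative at some
  skew-symmetric \<open>X\<close>. However, \<open>tr (X\<^sup>2) - (tr X)\<^sup>2\<close> is a null Lagrangian: its
  integral vanishes for fields with zero boundary values (\<open>integral_minors_form_eq_0\<close>). The coefficient
  \<open>mu\<close> of \<open>tr (X\<^sup>2)\<close> may therefore be changed to any weight \<open>s\<close>, provided
  that \<open>lam\<close> is changed to \<open>L - s\<close>.

  Rotating \<open>w\<close> to a basis vector decouples the entries of \<open>X\<close> into small groups, and the new
  form is nonnegative as soon as \<open>s\<^sup>2 \<le> mu\<^sup>2 (1 - g\<^sup>2)\<close> and \<open>(L - s)\<^sup>2
  \<le> N (1 - g\<^sup>2) ((mu + s) / (n - 1) + L - s)\<close>, where \<open>|s| \<le> mu\<close>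
  (\<open>pointwise_form_nonneg\<close>). The hypothesis on \<open>p\<close> says that \<open>1 - g\<^sup>2\<close> is
  at least \<open>\<kappa>\<^sup>2\<close> with \<open>\<kappa> = L / (max mu N + \<epsilon>)\<close>. For \<open>s =
  mu \<kappa>\<close> the first condition holds, and the second one holds with room to spare when \<open>\<epsilon> =
  0\<close>, hence also for some \<open>\<epsilon> > 0\<close> that depends on \<open>n\<close>, \<open>lam\<close>
  and \<open>mu\<close> only (\<open>null_lagrangian_weight_exists\<close>).

  The inclusion of the ranges of \<open>p\<close> is the inequality \<open>q\<^sup>2 \<le> q\<close> for \<open>q =
  |L| / max mu N \<le> 1\<close>.

  Since weak gradients enter through an arbitrary choice, the analytic half rests on their uniqueness almost
  everywhere, which is the fundamental lemma of the calculus of variations. Both integral identities, the null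
  Lagrangian and the chain rule for \<open>|v|\<close>, are first proved for test fields and then carried over by
  density (\<open>integral_eq_0_by_density\<close>).
\<close>

section \<open>Smooth functions and box-shaped bumps\<close>

abbreviation smooth :: "(real ^ 'n::finite \<Rightarrow> real) \<Rightarrow> bool"
  where "smooth f \<equiv> \<forall>k. Ck k f"

lemma partial_deriv_eq:
  assumes "(f has_derivative f') (at x)"
  shows "partial_deriv h f x = f' (axis h 1)"
  using frechet_derivative_at[OF assms] by (simp add: partial_deriv_def)

lemma Ck_differentiable: "Ck (Suc k) f \<Longrightarrow> f differentiable (at x)"
  by simp

lemma Ck_SucD: "Ck (Suc k) f \<Longrightarrow> Ck k f"
proof (induction k arbitrary: f)
  case 0
  then show ?case
    by (auto simp: continuous_on_eq_continuous_at intro: differentiable_imp_continuous_within)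
next
  case (Suc k)
  have "Ck (Suc k) (partial_deriv h f)" for h
    using Suc.prems by (metis Ck.simps(2))
  then have "Ck k (partial_deriv h f)" for h
    using Suc.IH by blast
  then show ?case
    using Suc.prems by auto
qed

lemma Ck_continuous: "Ck k f \<Longrightarrow> continuous_on UNIV f"
proof (induction k)
  case (Suc k)
  then show ?case using Ck_SucD by blast
qed simp

lemma smooth_differentiable: "smooth f \<Longrightarrow> f differentiable (at x)"
  by (metis Ck_differentiable)

lemma smooth_has_derivative:
  "smooth f \<Longrightarrow> (f has_derivative frechet_derivative f (at x)) (at x)"
  by (metis smooth_differentiable frechet_derivative_works)

lemma smooth_partial_deriv: "smooth f \<Longrightarrow> smooth (partial_deriv h f)"
  by (metis Ck.simps(2))

lemma partial_deriv_const: "partial_deriv h (\<lambda>x. c) = (\<lambda>x. 0)"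
  by (rule ext, subst partial_deriv_eq[OF has_derivative_const]) simp

lemma partial_deriv_add:
  assumes "f differentiable (at x)" "g differentiable (at x)"
  shows "partial_deriv h (\<lambda>x. f x + g x) x = partial_deriv h f x + partial_deriv h g x"
  by (subst partial_deriv_eq[OF has_derivative_add])
     (use assms in \<open>auto simp: partial_deriv_def frechet_derivative_works\<close>)

lemma partial_deriv_diff:
  assumes "f differentiable (at x)" "g differentiable (at x)"
  shows "partial_deriv h (\<lambda>x. f x - g x) x = partial_deriv h f x - partial_deriv h g x"
  by (subst partial_deriv_eq[OF has_derivative_diff])
     (use assms in \<open>auto simp: partial_deriv_def frechet_derivative_works\<close>)

lemma partial_deriv_mult:
  assumes "f differentiable (at x)" "g differentiable (at x)"
  shows "partial_deriv h (\<lambda>x. f x * g x) x = f x * partial_deriv h g x + partial_deriv h f x * g x"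
  by (subst partial_deriv_eq[OF has_derivative_mult])
     (use assms in \<open>auto simp: partial_deriv_def frechet_derivative_works\<close>)

lemma Ck_const: "Ck k (\<lambda>x. c)"
  by (induction k arbitrary: c) (auto simp: partial_deriv_const)

lemma Ck_add: "Ck k f \<Longrightarrow> Ck k g \<Longrightarrow> Ck k (\<lambda>x. f x + g x)"
proof (induction k arbitrary: f g)
  case (Suc k)
  have "partial_deriv h (\<lambda>x. f x + g x) = (\<lambda>x. partial_deriv h f x + partial_deriv h g x)" for h
    using Suc.prems by (auto intro!: partial_deriv_add)
  with Suc show ?case by simp
qed (auto intro: continuous_intros)

lemma Ck_mult: "Ck k f \<Longrightarrow> Ck k g \<Longrightarrow> Ck k (\<lambda>x. f x * g x)"
proof (induction k arbitrary: f g)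
  case (Suc k)
  have *: "partial_deriv h (\<lambda>x. f x * g x) =
      (\<lambda>x. f x * partial_deriv h g x + partial_deriv h f x * g x)" for h
    using Suc.prems by (auto intro!: partial_deriv_mult)
  have "Ck k f" "Ck k g"
    using Suc.prems Ck_SucD by blast+
  then have "Ck k (\<lambda>x. f x * partial_deriv h g x + partial_deriv h f x * g x)" for h
    using Suc by (auto intro!: Ck_add)
  with * Suc.prems show ?case by simp
qed (auto intro: continuous_intros)

lemma Ck_prod: "finite I \<Longrightarrow> (\<And>i. i \<in> I \<Longrightarrow> Ck k (f i)) \<Longrightarrow> Ck k (\<lambda>x. \<Prod>i\<in>I. f i x)"
  by (induction I rule: finite_induct) (auto intro: Ck_const Ck_mult)

text \<open>
  For \<open>t > 0\<close> the derivative of \<open>exp (- 1 / t) / t ^ m\<close> is a combination of the same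
  expression with \<open>m + 2\<close> and \<open>m + 1\<close>, so the family indexed by \<open>m\<close> is closed
  under differentiation, also across \<open>t = 0\<close>. Smoothness of the flat function \<open>m = 0\<close> then
  follows by an induction over all \<open>m\<close> at once.
\<close>

definition flat_exp :: "nat \<Rightarrow> real \<Rightarrow> real"
  where "flat_exp m t = (if t > 0 then exp (- 1 / t) / t ^ m else 0)"

lemma flat_exp_tendsto_0: "((\<lambda>t. exp (- 1 / t) / t ^ m) \<longlongrightarrow> 0) (at_right (0::real))"
proof -
  have "((\<lambda>x::real. x ^ m / exp x) \<longlongrightarrow> 0) at_top"
    by (rule tendsto_power_div_exp_0)
  then have "((\<lambda>t::real. inverse t ^ m / exp (inverse t)) \<longlongrightarrow> 0) (at_right 0)"
    by (rule filterlim_compose[OF _ filterlim_inverse_at_top_right])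
  then show ?thesis
    by (simp add: exp_minus field_simps)
qed

lemma DERIV_flat_exp: "DERIV (flat_exp m) t :> flat_exp (m + 2) t - m * flat_exp (Suc m) t"
proof -
  consider "t > 0" | "t < 0" | "t = 0" by linarith
  then show ?thesis
  proof cases
    case 1
    have "((\<lambda>t. exp (- 1 / t) / t ^ m) has_real_derivative
        flat_exp (m + 2) t - m * flat_exp (Suc m) t) (at t)"
      using 1
      apply (auto intro!: derivative_eq_intros simp: flat_exp_def)
      apply (cases m; simp add: field_simps power2_eq_square)
      done
    then show ?thesis
      by (rule has_field_derivative_transform_within_open[where S = "{0<..}"])
         (use 1 in \<open>auto simp: flat_exp_def\<close>)
  next
    case 2
    have "((\<lambda>t. 0) has_real_derivative flat_exp (m + 2) t - m * flat_exp (Suc m) t) (at t)"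
      using 2 by (auto simp: flat_exp_def)
    then show ?thesis
      by (rule has_field_derivative_transform_within_open[where S = "{..<0}"])
         (use 2 in \<open>auto simp: flat_exp_def\<close>)
  next
    case 3
    have "((\<lambda>h. (flat_exp m (0 + h) - flat_exp m 0) / h) \<longlongrightarrow> 0) (at 0)"
      unfolding filterlim_at_split
    proof
      show "((\<lambda>h. (flat_exp m (0 + h) - flat_exp m 0) / h) \<longlongrightarrow> 0) (at_left 0)"
        by (rule tendsto_eventually) (auto simp: eventually_at_filter flat_exp_def)
      show "((\<lambda>h. (flat_exp m (0 + h) - flat_exp m 0) / h) \<longlongrightarrow> 0) (at_right 0)"
        by (rule Lim_transform_eventually[OF flat_exp_tendsto_0[of "Suc m"]])
           (auto simp: eventually_at_filter flat_exp_def)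
    qed
    then show ?thesis
      using 3 by (simp add: DERIV_def flat_exp_def)
  qed
qed

lemma Ck_flat_exp_affine: "Ck k (\<lambda>x::real^'n::finite. flat_exp m (c * x $ i + d))"
proof (induction k arbitrary: m)
  case 0
  have "continuous_on UNIV (flat_exp m)"
    using DERIV_flat_exp DERIV_isCont continuous_at_imp_continuous_on by blast
  then show ?case
    by (auto intro!: continuous_on_compose2[of UNIV "flat_exp m"] continuous_intros)
next
  case (Suc k)
  have D: "((\<lambda>x::real^'n. flat_exp m (c * x $ i + d)) has_derivative
      (\<lambda>y. (c * y $ i) * (flat_exp (m + 2) (c * x $ i + d) - m * flat_exp (Suc m) (c * x $ i + d)))) (at x)" for x
  proof -
    have "((\<lambda>x::real^'n. c * x $ i + d) has_derivative (\<lambda>y. c * y $ i)) (at x)"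
      by (auto intro!: derivative_eq_intros bounded_linear_imp_has_derivative bounded_linear_vec_nth)
    from DERIV_compose_FDERIV[OF DERIV_flat_exp this] show ?thesis .
  qed
  have "partial_deriv h (\<lambda>x::real^'n. flat_exp m (c * x $ i + d)) =
      (\<lambda>x. (c * axis h 1 $ i) * (flat_exp (m + 2) (c * x $ i + d)
         + (- real m) * flat_exp (Suc m) (c * x $ i + d)))" for h
    by (rule ext, subst partial_deriv_eq[OF D]) simp
  moreover have "Ck k (\<lambda>x::real^'n. (c * axis h 1 $ i) * (flat_exp (m + 2) (c * x $ i + d)
         + (- real m) * flat_exp (Suc m) (c * x $ i + d)))" for h
    by (intro Ck_mult Ck_add Ck_const Suc)
  ultimately show ?case
    using D by (auto simp: differentiable_def)
qed

text \<open>
  The scale \<open>k\<close> enters only the arguments: since \<open>exp (- 1 / (k * t))\<close> increases to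
  \<open>1\<close> as \<open>k\<close> grows, these products tend to the indicator of the open box while vanishing
  outside it for every \<open>k\<close>.
\<close>

definition box_bump :: "real ^ 'n \<Rightarrow> real ^ 'n \<Rightarrow> nat \<Rightarrow> real ^ 'n::finite \<Rightarrow> real"
  where "box_bump a b k x =
    (\<Prod>i\<in>UNIV. flat_exp 0 (real k * (x $ i - a $ i)) * flat_exp 0 (real k * (b $ i - x $ i)))"

lemma flat_exp_0_bounds: "0 \<le> flat_exp 0 t" "flat_exp 0 t \<le> 1"
  by (auto simp: flat_exp_def)

lemma box_bump_bounds: "0 \<le> box_bump a b k x" "box_bump a b k x \<le> 1"
  by (auto simp: box_bump_def flat_exp_0_bounds intro!: prod_nonneg prod_le_1 mult_le_one)

lemma smooth_box_bump: "smooth (box_bump a b k)"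
proof
  fix j
  have "Ck j (\<lambda>x. flat_exp 0 (real k * (x $ i - a $ i)) * flat_exp 0 (real k * (b $ i - x $ i)))" for i
    using Ck_mult[OF Ck_flat_exp_affine[of j 0 "real k" i "- (real k * a $ i)"]
        Ck_flat_exp_affine[of j 0 "- real k" i "real k * b $ i"]]
    by (simp add: algebra_simps)
  then show "Ck j (box_bump a b k)"
    unfolding box_bump_def[abs_def] by (intro Ck_prod) auto
qed

lemma box_bump_eq_0: "x \<notin> box a b \<Longrightarrow> box_bump a b k x = 0"
  by (auto simp: box_bump_def mem_box_cart flat_exp_def mult_le_0_iff zero_less_mult_iff)

lemma box_bump_tendsto: "(\<lambda>k. box_bump a b k x) \<longlonglongrightarrow> indicator (box a b) x"
proof (cases "x \<in> box a b")
  case False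
  then show ?thesis by (simp add: box_bump_eq_0)
next
  case True
  have *: "(\<lambda>k. flat_exp 0 (real k * t)) \<longlonglongrightarrow> 1" if "t > 0" for t
  proof -
    have "(\<lambda>k. exp (- (1 / t) * (1 / real k))) \<longlonglongrightarrow> exp (- (1 / t) * 0)"
      by (intro tendsto_intros lim_1_over_n)
    then have "(\<lambda>k. exp (- (1 / t) * (1 / real k))) \<longlonglongrightarrow> 1" by simp
    then show ?thesis
      by (rule Lim_transform_eventually)
         (use that in \<open>auto simp: flat_exp_def eventually_sequentially field_simps intro!: exI[of _ 1]\<close>)
  qed
  have "(\<lambda>k. box_bump a b k x) \<longlonglongrightarrow> (\<Prod>i\<in>(UNIV::'a set). 1 * 1)"
    unfolding box_bump_def using True
    by (intro tendsto_prod tendsto_mult *) (auto simp: mem_box_cart)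
  then show ?thesis using True by simp
qed

lemma test_function_box_bump:
  assumes "cbox a b \<subseteq> \<Omega>"
  shows "test_function \<Omega> (box_bump a b k)"
proof -
  have "{x. box_bump a b k x \<noteq> 0} \<subseteq> cbox a b"
    using box_bump_eq_0 box_subset_cbox by blast
  then have "closure {x. box_bump a b k x \<noteq> 0} \<subseteq> cbox a b"
    by (simp add: closure_minimal closed_cbox)
  then show ?thesis
    using assms smooth_box_bump compact_closure bounded_cbox bounded_subset
      \<open>{x. box_bump a b k x \<noteq> 0} \<subseteq> cbox a b\<close>
    unfolding test_function_def by (metis order_trans)
qed


section \<open>Integration by parts\<close>

lemma partial_deriv_eq_0_outside:
  assumes "closed K" "\<And>x. x \<notin> K \<Longrightarrow> f x = 0" "x \<notin> K"
  shows "partial_deriv h f x = 0"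
proof -
  have "(f has_derivative (\<lambda>_. 0)) (at x)"
    by (rule has_derivative_transform_within_open[where s = "- K" and f = "\<lambda>_. 0"]) (use assms in auto)
  from partial_deriv_eq[OF this] show ?thesis .
qed

lemma has_real_derivative_along_axis:
  assumes "\<And>x. f differentiable (at x)"
  shows "((\<lambda>s. f (x + s *\<^sub>R axis h 1)) has_real_derivative
    partial_deriv h f (x + s *\<^sub>R axis h 1)) (at s)"
proof -
  let ?F = "frechet_derivative f (at (x + s *\<^sub>R axis h 1))"
  have F: "(f has_derivative ?F) (at (x + s *\<^sub>R axis h 1))"
    using assms frechet_derivative_works by blast
  have "((\<lambda>s. x + s *\<^sub>R axis h 1) has_derivative (\<lambda>u. u *\<^sub>R axis h 1)) (at s)"
    by (auto intro!: derivative_eq_intros)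
  from has_derivative_compose[OF this F]
  have "((\<lambda>s. f (x + s *\<^sub>R axis h 1)) has_derivative (\<lambda>u. ?F (u *\<^sub>R axis h 1))) (at s)" .
  moreover have "?F (u *\<^sub>R axis h 1) = partial_deriv h f (x + s *\<^sub>R axis h 1) * u" for u
    using has_derivative_bounded_linear[OF F]
    by (simp add: partial_deriv_def linear_simps)
  ultimately show ?thesis
    by (simp add: has_field_derivative_def)
qed

lemma partial_deriv_mean_value:
  assumes "\<And>x. f differentiable (at x)" "0 < t"
  obtains z where "0 < z" "z < t"
    "f (x + t *\<^sub>R axis h 1) - f x = t * partial_deriv h f (x + z *\<^sub>R axis h 1)"
proof -
  have "\<exists>z. 0 < z \<and> z < t \<and> f (x + t *\<^sub>R axis h 1) - f (x + 0 *\<^sub>R axis h 1) =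
      (t - 0) * partial_deriv h f (x + z *\<^sub>R axis h 1)"
    by (rule MVT2[OF assms(2)]) (rule has_real_derivative_along_axis[OF assms(1)])
  then show ?thesis
    using that by auto
qed

lemma continuous_bounded_if_compact_support:
  fixes g :: "'a::euclidean_space \<Rightarrow> real"
  assumes "continuous_on UNIV g" "compact K" "\<And>x. x \<notin> K \<Longrightarrow> g x = 0"
  obtains C where "0 \<le> C" "\<And>x. \<bar>g x\<bar> \<le> C"
proof -
  have "bounded (g ` K)"
    using continuous_on_subset[OF assms(1) subset_UNIV] assms(2)
    by (intro compact_imp_bounded compact_continuous_image)
  then obtain B where B: "\<And>x. x \<in> K \<Longrightarrow> \<bar>g x\<bar> \<le> B"
    unfolding bounded_iff by auto
  have "\<bar>g x\<bar> \<le> max B 0" for x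
    using B assms(3)[of x] by (cases "x \<in> K") (auto simp: le_max_iff_disj)
  then show ?thesis
    using that[of "max B 0"] by auto
qed

lemma integrable_continuous_compact_support:
  fixes g :: "'a::euclidean_space \<Rightarrow> real"
  assumes "continuous_on UNIV g" "compact K" "\<And>x. x \<notin> K \<Longrightarrow> g x = 0"
  shows "integrable lborel g"
proof -
  have "integrable lborel (\<lambda>x. indicator K x *\<^sub>R g x)"
    using assms by (intro borel_integrable_compact) (auto intro: continuous_on_subset)
  moreover have "(\<lambda>x. indicator K x *\<^sub>R g x) = g"
    using assms(3) by (auto simp: indicator_def fun_eq_iff)
  ultimately show ?thesis by simp
qed

lemma integral_lborel_shift:
  fixes f :: "'a::euclidean_space \<Rightarrow> real"
  assumes "f \<in> borel_measurable borel"
  shows "(LINT x|lborel. f (x + c)) = (LINT x|lborel. f x)"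
proof -
  have "(LINT x|lborel. f x) = (LINT x|distr lborel borel ((+) c). f x)"
    by (simp add: lborel_distr_plus)
  also have "\<dots> = (LINT x|lborel. f (c + x))"
    by (rule integral_distr) (use assms in auto)
  finally show ?thesis by (simp add: add.commute)
qed

text \<open>
  The integral of a difference quotient vanishes by translation invariance, and by the mean value theorem the
  quotients are dominated by a multiple of the indicator of a fixed ball.
\<close>

lemma integral_partial_deriv_eq_0:
  fixes f :: "real ^ 'n::finite \<Rightarrow> real"
  assumes diff: "\<And>x. f differentiable (at x)" and cont: "continuous_on UNIV (partial_deriv h f)"
    and K: "compact K" "\<And>x. x \<notin> K \<Longrightarrow> f x = 0"
  shows "(LINT x|lborel. partial_deriv h f x) = 0"
proof -
  let ?D = "partial_deriv h f" and ?e = "axis h 1 :: real ^ 'n"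
  define t where "t n = 1 / real (Suc n)" for n
  have t: "0 < t n" "t n \<le> 1" for n
    by (auto simp: t_def)
  have t0: "t \<longlonglongrightarrow> 0"
    unfolding t_def using LIMSEQ_Suc lim_1_over_n by blast
  define q where "q n x = (f (x + t n *\<^sub>R ?e) - f x) / t n" for n x
  have D0: "?D x = 0" if "x \<notin> K" for x
    using partial_deriv_eq_0_outside that K compact_imp_closed by blast
  obtain C where C: "0 \<le> C" "\<And>x. \<bar>?D x\<bar> \<le> C"
    using continuous_bounded_if_compact_support[OF cont K(1) D0] by blast
  obtain R where R: "\<And>x. x \<in> K \<Longrightarrow> norm x \<le> R"
    using compact_imp_bounded[OF K(1)] unfolding bounded_iff by blast
  define S where "S = cball (0 :: real ^ 'n) (R + 1)"
  have contf: "continuous_on UNIV f"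
    using diff by (simp add: continuous_on_eq_continuous_at differentiable_imp_continuous_within)
  have fm: "f \<in> borel_measurable borel"
    by (rule borel_measurable_continuous_onI[OF contf])
  have intf: "integrable lborel f"
    by (rule integrable_continuous_compact_support[OF contf K])
  have shift: "integrable lborel (\<lambda>x. f (x + c))" for c
  proof (rule integrable_continuous_compact_support)
    show "continuous_on UNIV (\<lambda>x. f (x + c))"
      by (rule continuous_on_compose2[OF contf]) (auto intro: continuous_intros)
    show "compact ((\<lambda>x. x - c) ` K)"
      by (rule compact_continuous_image) (auto intro!: continuous_intros K)
    show "f (x + c) = 0" if "x \<notin> (\<lambda>x. x - c) ` K" for x
      using that by (intro K(2)) force
  qed
  have q0: "(LINT x|lborel. q n x) = 0" for n
    unfolding q_def by (simp add: Bochner_Integration.integral_diff[OF shift intf] integral_lborel_shift[OF fm])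
  have bound: "\<bar>q n x\<bar> \<le> C * indicator S x" for n x
  proof (cases "x \<in> S")
    case True
    obtain z where "f (x + t n *\<^sub>R ?e) - f x = t n * ?D (x + z *\<^sub>R ?e)"
      using partial_deriv_mean_value[OF diff t(1)] by blast
    then have "q n x = ?D (x + z *\<^sub>R ?e)"
      using t(1)[of n] by (simp add: q_def)
    then show ?thesis
      using C True by simp
  next
    case False
    have "x \<notin> K" using False R[of x] by (auto simp: S_def)
    moreover have "x + t n *\<^sub>R ?e \<notin> K"
    proof
      assume "x + t n *\<^sub>R ?e \<in> K"
      then have "norm (x + t n *\<^sub>R ?e) \<le> R" by (rule R)
      moreover have "norm x \<le> norm (x + t n *\<^sub>R ?e) + norm (t n *\<^sub>R ?e)"
        by (metis add_diff_cancel norm_triangle_ineq4)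
      moreover have "norm (t n *\<^sub>R ?e) \<le> 1"
        using t[of n] by (simp add: norm_axis_1)
      ultimately show False using False by (simp add: S_def)
    qed
    ultimately show ?thesis using K(2) False by (simp add: q_def)
  qed
  have lim: "(\<lambda>n. q n x) \<longlonglongrightarrow> ?D x" for x
  proof -
    have "((\<lambda>u. (f (x + (0 + u) *\<^sub>R ?e) - f (x + 0 *\<^sub>R ?e)) / u) \<longlongrightarrow> ?D (x + 0 *\<^sub>R ?e)) (at 0)"
      using has_real_derivative_along_axis[OF diff, of x h 0] unfolding DERIV_def .
    moreover have "filterlim t (at 0) sequentially"
      using t0 t(1) by (auto simp: filterlim_at less_imp_neq[symmetric])
    ultimately show ?thesis
      unfolding q_def using filterlim_compose by fastforce
  qed
  have "(\<lambda>n. LINT x|lborel. q n x) \<longlonglongrightarrow> (LINT x|lborel. ?D x)"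
  proof (rule integral_dominated_convergence[where w = "\<lambda>x. C * indicator S x"])
    show "?D \<in> borel_measurable lborel"
      using borel_measurable_continuous_onI[OF cont] by simp
    show "q n \<in> borel_measurable lborel" for n
      using fm unfolding q_def by measurable
    have "emeasure lborel S < \<infinity>"
      unfolding S_def by (rule emeasure_lborel_cball_finite)
    then show "integrable lborel (\<lambda>x. C * indicator S x)"
      unfolding S_def by (intro integrable_mult_right integrable_real_indicator) auto
  qed (use lim bound in auto)
  then show ?thesis
    unfolding q0 by (simp add: LIMSEQ_const_iff)
qed

lemma integral_lebesgue_on_eq_lborel:
  fixes g :: "'a::euclidean_space \<Rightarrow> real"
  assumes "open \<Omega>" "\<And>x. x \<notin> \<Omega> \<Longrightarrow> g x = 0" "g \<in> borel_measurable borel"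
  shows "(LINT x|lebesgue_on \<Omega>. g x) = (LINT x|lborel. g x)"
proof -
  have "(LINT x|lebesgue_on \<Omega>. g x) = (LINT x|lebesgue. indicator \<Omega> x *\<^sub>R g x)"
    using assms(1) by (intro integral_restrict_space) auto
  also have "(\<lambda>x. indicator \<Omega> x *\<^sub>R g x) = g"
    using assms(2) by (auto simp: indicator_def fun_eq_iff)
  finally show ?thesis
    using assms(3) by (simp add: integral_completion)
qed

lemma test_function_support:
  assumes "test_function \<Omega> \<phi>"
  obtains K where "compact K" "K \<subseteq> \<Omega>" "\<And>x. x \<notin> K \<Longrightarrow> \<phi> x = 0"
    "\<And>x h. x \<notin> K \<Longrightarrow> partial_deriv h \<phi> x = 0"
proof
  let ?K = "closure {x. \<phi> x \<noteq> 0}"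
  show "compact ?K" "?K \<subseteq> \<Omega>"
    using assms by (auto simp: test_function_def)
  show 0: "\<phi> x = 0" if "x \<notin> ?K" for x
    using that closure_subset[of "{x. \<phi> x \<noteq> 0}"] by auto
  show "partial_deriv h \<phi> x = 0" if "x \<notin> ?K" for x h
    using partial_deriv_eq_0_outside[OF closed_closure 0 that] .
qed

lemma test_function_smooth: "test_function \<Omega> \<phi> \<Longrightarrow> smooth \<phi>"
  by (simp add: test_function_def)

lemma test_function_partial_deriv:
  assumes "test_function \<Omega> \<phi>"
  shows "test_function \<Omega> (partial_deriv h \<phi>)"
proof -
  obtain K where K: "compact K" "K \<subseteq> \<Omega>" "\<And>x h. x \<notin> K \<Longrightarrow> partial_deriv h \<phi> x = 0"
    using test_function_support[OF assms] by metis
  have sub: "{x. partial_deriv h \<phi> x \<noteq> 0} \<subseteq> K"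
    using K(3) by auto
  then have "closure {x. partial_deriv h \<phi> x \<noteq> 0} \<subseteq> \<Omega>"
    using closure_minimal[OF sub compact_imp_closed[OF K(1)]] K(2) by (rule_tac order_trans)
  moreover have "compact (closure {x. partial_deriv h \<phi> x \<noteq> 0})"
    using bounded_subset[OF compact_imp_bounded[OF K(1)] sub] by (simp add: compact_closure)
  ultimately show ?thesis
    using smooth_partial_deriv[OF test_function_smooth[OF assms]] by (simp add: test_function_def)
qed

text \<open>
  The product \<open>u \<psi>\<close> has compact support, so its partial derivative integrates to \<open>0\<close>.
\<close>

lemma integration_by_parts:
  fixes u :: "real ^ 'n::finite \<Rightarrow> real"
  assumes \<Omega>: "open \<Omega>" and \<psi>: "test_function \<Omega> \<psi>" and u: "\<And>x. u differentiable (at x)"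
    and cont: "continuous_on UNIV (partial_deriv h u)"
  shows "(LINT x|lebesgue_on \<Omega>. u x * partial_deriv h \<psi> x) =
    - (LINT x|lebesgue_on \<Omega>. partial_deriv h u x * \<psi> x)"
proof -
  obtain K where K: "compact K" "K \<subseteq> \<Omega>" "\<And>x. x \<notin> K \<Longrightarrow> \<psi> x = 0"
    "\<And>x. x \<notin> K \<Longrightarrow> partial_deriv h \<psi> x = 0"
    using test_function_support[OF \<psi>] by metis
  have cu: "continuous_on UNIV u"
    using u by (simp add: continuous_on_eq_continuous_at differentiable_imp_continuous_within)
  have sm: "smooth \<psi>" "smooth (partial_deriv h \<psi>)"
    using test_function_smooth[OF \<psi>] smooth_partial_deriv by blast+
  note c\<psi> = Ck_continuous[OF sm(1)[rule_format, of 0]] Ck_continuous[OF sm(2)[rule_format, of 0]]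
  have c1: "continuous_on UNIV (\<lambda>x. u x * partial_deriv h \<psi> x)"
    and c2: "continuous_on UNIV (\<lambda>x. partial_deriv h u x * \<psi> x)"
    by (intro continuous_intros cu cont c\<psi>)+
  have i1: "integrable lborel (\<lambda>x. u x * partial_deriv h \<psi> x)"
    by (rule integrable_continuous_compact_support[OF c1 K(1)]) (simp add: K)
  have i2: "integrable lborel (\<lambda>x. partial_deriv h u x * \<psi> x)"
    by (rule integrable_continuous_compact_support[OF c2 K(1)]) (simp add: K)
  have D: "partial_deriv h (\<lambda>x. u x * \<psi> x) = (\<lambda>x. u x * partial_deriv h \<psi> x + partial_deriv h u x * \<psi> x)"
    using smooth_differentiable[OF sm(1)] u by (auto intro!: partial_deriv_mult)
  have "(LINT x|lborel. partial_deriv h (\<lambda>x. u x * \<psi> x) x) = 0"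
  proof (rule integral_partial_deriv_eq_0[OF _ _ K(1)])
    show "(\<lambda>x. u x * \<psi> x) differentiable (at x)" for x
      using smooth_differentiable[OF sm(1)] u by (intro differentiable_mult)
    show "continuous_on UNIV (partial_deriv h (\<lambda>x. u x * \<psi> x))"
      unfolding D by (intro continuous_intros c1 c2)
  qed (simp add: K)
  then have "(LINT x|lborel. u x * partial_deriv h \<psi> x) + (LINT x|lborel. partial_deriv h u x * \<psi> x) = 0"
    unfolding D using i1 i2 by simp
  moreover have "(LINT x|lebesgue_on \<Omega>. u x * partial_deriv h \<psi> x) = (LINT x|lborel. u x * partial_deriv h \<psi> x)"
    "(LINT x|lebesgue_on \<Omega>. partial_deriv h u x * \<psi> x) = (LINT x|lborel. partial_deriv h u x * \<psi> x)"
    using subsetD[OF K(2)] K(3,4) \<Omega>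
    by (intro integral_lebesgue_on_eq_lborel borel_measurable_continuous_onI[OF c1]
        borel_measurable_continuous_onI[OF c2]; metis mult_zero_left mult_zero_right)+
  ultimately show ?thesis by simp
qed

section \<open>The fundamental lemma of the calculus of variations\<close>

lemma borel_measurable_lebesgue_continuous:
  fixes g :: "'a::euclidean_space \<Rightarrow> 'b::topological_space"
  assumes "continuous_on UNIV g"
  shows "g \<in> borel_measurable lebesgue"
  using borel_measurable_continuous_onI[OF assms] by (simp add: measurable_completion)

lemma integrable_locally_integrable_mult:
  assumes \<Omega>: "open \<Omega>" and f: "locally_integrable \<Omega> f" and \<phi>: "continuous_on UNIV \<phi>"
    and K: "compact K" "K \<subseteq> \<Omega>" "\<And>x. x \<notin> K \<Longrightarrow> \<phi> x = 0"
  shows "integrable (lebesgue_on \<Omega>) (\<lambda>x. f x * \<phi> x)"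
proof -
  obtain C where C: "0 \<le> C" "\<And>x. \<bar>\<phi> x\<bar> \<le> C"
    using continuous_bounded_if_compact_support[OF \<phi> K(1,3)] by blast
  have i: "integrable lebesgue (\<lambda>x. indicator K x *\<^sub>R f x)"
    using f K unfolding locally_integrable_def set_integrable_def by blast
  have "integrable lebesgue (\<lambda>x. (indicator K x *\<^sub>R f x) * \<phi> x)"
  proof (rule Bochner_Integration.integrable_bound)
    show "integrable lebesgue (\<lambda>x. C * (indicator K x *\<^sub>R f x))"
      using i by simp
    have "\<phi> \<in> borel_measurable lebesgue"
      by (rule borel_measurable_lebesgue_continuous[OF \<phi>])
    then show "(\<lambda>x. (indicator K x *\<^sub>R f x) * \<phi> x) \<in> borel_measurable lebesgue"
      using i by (intro borel_measurable_times) auto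
    show "AE x in lebesgue. norm ((indicator K x *\<^sub>R f x) * \<phi> x) \<le> norm (C * (indicator K x *\<^sub>R f x))"
      using C by (auto simp: abs_mult indicator_def mult.commute intro!: mult_right_mono)
  qed
  moreover have "(\<lambda>x. (indicator K x *\<^sub>R f x) * \<phi> x) = (\<lambda>x. indicator \<Omega> x *\<^sub>R (f x * \<phi> x))"
    using K by (auto simp: indicator_def fun_eq_iff)
  ultimately show ?thesis
    using \<Omega> by (subst integrable_restrict_space) auto
qed

lemma integrable_locally_integrable_test_function:
  assumes "open \<Omega>" "locally_integrable \<Omega> f" "test_function \<Omega> \<phi>"
  shows "integrable (lebesgue_on \<Omega>) (\<lambda>x. f x * \<phi> x)"
  using test_function_support[OF assms(3)] integrable_locally_integrable_mult[OF assms(1,2)]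
    Ck_continuous test_function_smooth[OF assms(3)] by metis

text \<open>
  Open boxes are stable under intersection and generate the Borel sets, and vanishing of the integral passes to
  complements and to disjoint unions (Dynkin's \<open>\<pi>\<close>-\<open>\<lambda>\<close> argument).
\<close>

lemma set_integral_zero_if_zero_on_boxes:
  fixes f :: "'a::euclidean_space \<Rightarrow> real"
  assumes f: "integrable lborel f" and f0: "(LINT x|lborel. f x) = 0"
    and box: "\<And>a b. (LINT x:box a b|lborel. f x) = 0" and A: "A \<in> sets borel"
  shows "(LINT x:A|lborel. f x) = 0"
proof -
  have si: "set_integrable lborel A f" if "A \<in> sets borel" for A
    using that f unfolding set_integrable_def by (intro integrable_mult_indicator) auto
  have "Int_stable (range (\<lambda>(a, b). box a b :: 'a set))"
    by (auto simp: Int_stable_def box_Int_box)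
  moreover have "(range (\<lambda>(a, b). box a b :: 'a set)) \<subseteq> Pow UNIV"
    by auto
  moreover have "A \<in> sigma_sets UNIV (range (\<lambda>(a, b). box a b))"
    using A unfolding borel_eq_box by simp
  ultimately show ?thesis
  proof (induction rule: sigma_sets_induct_disjoint)
    case (basic A)
    then show ?case using box by auto
  next
    case (compl A)
    then have A: "A \<in> sets borel" by (simp add: borel_eq_box)
    then have "(LINT x:A \<union> (UNIV - A)|lborel. f x) = (LINT x:A|lborel. f x) + (LINT x:UNIV - A|lborel. f x)"
      by (intro set_integral_Un si) auto
    then show ?case
      using compl f0 by (simp add: set_lebesgue_integral_def Compl_eq_Diff_UNIV)
  next
    case (union F)
    then have F: "F i \<in> sets borel" for i by (auto simp: borel_eq_box)
    have "(LINT x:(\<Union>i. F i)|lborel. f x) = (\<Sum>i. (LINT x:(F i)|lborel. f x))"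
      using union F by (intro lebesgue_integral_countable_add si) (auto simp: disjoint_family_on_def)
    then show ?case using union by simp
  qed (simp add: set_lebesgue_integral_def)
qed

lemma AE_zero_if_zero_on_boxes:
  fixes f :: "'a::euclidean_space \<Rightarrow> real"
  assumes f: "integrable lebesgue f" and f0: "(LINT x|lebesgue. f x) = 0"
    and box: "\<And>a b. (LINT x:box a b|lebesgue. f x) = 0"
  shows "AE x in lebesgue. f x = 0"
proof -
  have "f \<in> borel_measurable lebesgue" using f by auto
  then obtain g where g: "g \<in> borel_measurable lborel" "AE x in lborel. f x = g x"
    using completion_ex_borel_measurable_real by blast
  have gm: "g \<in> borel_measurable lebesgue"
    using g(1) by (rule measurable_completion)
  have fg: "AE x in lebesgue. f x = g x"
    using g(2) by (rule AE_completion)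
  have "integrable lebesgue g"
    by (rule integrable_cong_AE_imp[OF f gm]) (use fg in \<open>auto simp: eq_commute\<close>)
  then have gi: "integrable lborel g"
    using g(1) by (simp add: integrable_completion)
  have eq: "(LINT x:A|lborel. g x) = (LINT x:A|lebesgue. f x)" if [measurable]: "A \<in> sets borel" for A
  proof -
    have A: "A \<in> sets lebesgue" using that by simp
    have "(LINT x:A|lborel. g x) = (LINT x:A|lebesgue. g x)"
      using g(1) unfolding set_lebesgue_integral_def by (subst integral_completion) auto
    also have "\<dots> = (LINT x:A|lebesgue. f x)"
      unfolding set_lebesgue_integral_def using fg
      by (intro integral_cong_AE borel_measurable_scaleR borel_measurable_indicator A gm
          borel_measurable_integrable[OF f]) auto
    finally show ?thesis .
  qed
  have "AE x in lborel. g x = 0"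
  proof (rule sigma_finite_measure.density_zero[OF lborel.sigma_finite_measure_axioms gi])
    fix A :: "'a set" assume "A \<in> sets lborel"
    then have A: "A \<in> sets borel" by simp
    have g0: "(LINT x|lborel. g x) = 0"
      using eq[of UNIV] f0 by (simp add: set_lebesgue_integral_def)
    have "(LINT x:box a b|lborel. g x) = 0" for a b
      using eq[of "box a b"] box by simp
    from set_integral_zero_if_zero_on_boxes[OF gi g0 this A]
    show "set_lebesgue_integral lborel A g = 0" .
  qed
  from AE_completion[OF this] fg show ?thesis
    by eventually_elim simp
qed

text \<open>
  Testing with bumps that increase to the indicator of a box shows that \<open>g\<close> integrates to
  \<open>0\<close> over every box whose closure lies in \<open>\<Omega>\<close>, hence vanishes almost everywhere on
  it; countably many such boxes cover \<open>\<Omega>\<close>.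
\<close>

lemma fundamental_lemma_calculus_of_variations:
  fixes g :: "real ^ 'n::finite \<Rightarrow> real"
  assumes \<Omega>: "open \<Omega>" and g: "locally_integrable \<Omega> g"
    and test: "\<And>\<phi>. test_function \<Omega> \<phi> \<Longrightarrow> (LINT x|lebesgue_on \<Omega>. g x * \<phi> x) = 0"
  shows "AE x in lebesgue_on \<Omega>. g x = 0"
proof -
  have box0: "(LINT x:box a b|lebesgue. g x) = 0" if ab: "cbox a b \<subseteq> \<Omega>" for a b
  proof -
    have cg: "integrable lebesgue (\<lambda>x. indicator (cbox a b) x * g x)"
      using g[unfolded locally_integrable_def, rule_format, of "cbox a b"] ab
      by (simp add: set_integrable_def)
    note cgm = borel_measurable_integrable[OF cg]
    have *: "indicator \<Omega> x * (g x * box_bump a b k x) = (indicator (cbox a b) x * g x) * box_bump a b k x" for k x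
      using ab box_bump_eq_0[of x a b k] box_subset_cbox[of a b] by (auto simp: indicator_def)
    have z: "(LINT x|lebesgue. (indicator (cbox a b) x * g x) * box_bump a b k x) = 0" for k
      using test[OF test_function_box_bump[OF ab], of k] \<Omega>
      by (subst (asm) integral_restrict_space) (auto simp: *)
    have "(\<lambda>k. LINT x|lebesgue. (indicator (cbox a b) x * g x) * box_bump a b k x) \<longlonglongrightarrow>
        (LINT x|lebesgue. indicator (box a b) x * g x)"
    proof (rule integral_dominated_convergence[where w = "\<lambda>x. norm (indicator (cbox a b) x * g x)"])
      show "integrable lebesgue (\<lambda>x. norm (indicator (cbox a b) x * g x))"
        using cg by (rule integrable_norm)
      have "box_bump a b k \<in> borel_measurable lebesgue" for k
        by (rule borel_measurable_lebesgue_continuous[OF Ck_continuous[OF smooth_box_bump[rule_format, of 0]]])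
      then show "(\<lambda>x. (indicator (cbox a b) x * g x) * box_bump a b k x) \<in> borel_measurable lebesgue" for k
        by (intro borel_measurable_times[OF cgm])
      have "(\<lambda>x. indicator (box a b) x * (indicator (cbox a b) x * g x)) \<in> borel_measurable lebesgue"
        by (intro borel_measurable_times[OF _ cgm] borel_measurable_indicator) auto
      moreover have "(\<lambda>x. indicator (box a b) x * (indicator (cbox a b) x * g x)) = (\<lambda>x. indicator (box a b) x * g x)"
        using box_subset_cbox[of a b] by (auto simp: indicator_def fun_eq_iff)
      ultimately show "(\<lambda>x. indicator (box a b) x * g x) \<in> borel_measurable lebesgue"
        by simp
      have "(\<lambda>k. (indicator (cbox a b) x * g x) * box_bump a b k x) \<longlonglongrightarrow>
          (indicator (cbox a b) x * g x) * indicator (box a b) x" for x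
        by (intro tendsto_intros box_bump_tendsto)
      moreover have "(indicator (cbox a b) x * g x) * indicator (box a b) x = indicator (box a b) x * g x" for x
        using box_subset_cbox[of a b] by (auto simp: indicator_def)
      ultimately show "AE x in lebesgue. (\<lambda>k. (indicator (cbox a b) x * g x) * box_bump a b k x) \<longlonglongrightarrow>
          indicator (box a b) x * g x" by simp
      show "AE x in lebesgue. norm (indicat_real (cbox a b) x * g x * box_bump a b k x)
          \<le> norm (indicat_real (cbox a b) x * g x)" for k
        using box_bump_bounds[of a b k] by (auto simp: abs_mult intro!: mult_left_le)
    qed
    then have "(LINT x|lebesgue. indicator (box a b) x * g x) = 0"
      unfolding z by (simp add: LIMSEQ_const_iff)
    then show ?thesis by (simp add: set_lebesgue_integral_def)
  qed
  have cbox: "AE x in lebesgue. x \<in> cbox c d \<longrightarrow> g x = 0" if cd: "cbox c d \<subseteq> \<Omega>" for c d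
  proof -
    have "AE x in lebesgue. indicator (box c d) x * g x = 0"
    proof (rule AE_zero_if_zero_on_boxes)
      have "set_integrable lebesgue (cbox c d) g"
        using g[unfolded locally_integrable_def, rule_format, of "cbox c d"] cd by simp
      then have "set_integrable lebesgue (box c d) g"
        by (rule set_integrable_subset) (auto simp: box_subset_cbox)
      then show "integrable lebesgue (\<lambda>x. indicator (box c d) x * g x)"
        by (simp add: set_integrable_def)
      show "(LINT x|lebesgue. indicator (box c d) x * g x) = 0"
        using box0[OF cd] by (simp add: set_lebesgue_integral_def)
      fix a b :: "real ^ 'n"
      obtain l u where lu: "box a b \<inter> box c d = box l u" "box l u = {} \<or> cbox l u \<subseteq> cbox c d"
      proof -
        have e: "box a b \<inter> box c d = box (\<Sum>i\<in>Basis. max (a \<bullet> i) (c \<bullet> i) *\<^sub>R i) (\<Sum>i\<in>Basis. min (b \<bullet> i) (d \<bullet> i) *\<^sub>R i)"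
          by (rule box_Int_box)
        show ?thesis
          by (rule that[OF e]) (auto simp: mem_box)
      qed
      have "(LINT x:box l u|lebesgue. g x) = 0"
      proof (cases "box l u = {}")
        case False
        then show ?thesis using lu cd by (intro box0) auto
      qed (simp add: set_lebesgue_integral_def)
      moreover have "indicat_real (box a b) x *\<^sub>R (indicat_real (box c d) x * g x) = indicator (box l u) x *\<^sub>R g x" for x
        unfolding lu(1)[symmetric] by (simp add: indicator_inter_arith)
      ultimately show "(LINT x:box a b|lebesgue. indicat_real (box c d) x * g x) = 0"
        by (simp only: set_lebesgue_integral_def)
    qed
    \<comment> \<open>The boundary of a box is a null set.\<close>
    moreover have "AE x in lebesgue. x \<notin> cbox c d - box c d"
      using negligible_frontier_interval[of c d] by (intro AE_not_in) (simp add: negligible_iff_null_sets)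
    ultimately show ?thesis
      by eventually_elim (auto simp: indicator_def)
  qed
  obtain \<D> where \<D>: "countable \<D>" "\<D> \<subseteq> Pow \<Omega>" "\<And>X. X \<in> \<D> \<Longrightarrow> \<exists>a b. X = cbox a b" "\<Union>\<D> = \<Omega>"
    using open_countable_Union_open_cbox[OF \<Omega>] by metis
  have "AE x in lebesgue. x \<in> X \<longrightarrow> g x = 0" if X: "X \<in> \<D>" for X
  proof -
    obtain a b where "X = cbox a b" using \<D>(3)[OF X] by blast
    then show ?thesis using cbox[of a b] \<D>(2) X by auto
  qed
  then have "AE x in lebesgue. \<forall>X\<in>\<D>. x \<in> X \<longrightarrow> g x = 0"
    by (subst AE_ball_countable[OF \<D>(1)]) blast
  then have "AE x in lebesgue. x \<in> \<Omega> \<longrightarrow> g x = 0"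
    by eventually_elim (use \<D> in blast)
  then show ?thesis
    using \<Omega> by (subst AE_restrict_space_iff) auto
qed


section \<open>Uniqueness of weak gradients\<close>

lemma locally_integrable_diff:
  "locally_integrable \<Omega> f \<Longrightarrow> locally_integrable \<Omega> g \<Longrightarrow> locally_integrable \<Omega> (\<lambda>x. f x - g x)"
  by (simp add: locally_integrable_def set_integral_diff)

lemma locally_integrable_continuous:
  fixes u :: "real ^ 'n::finite \<Rightarrow> real"
  assumes "continuous_on UNIV u"
  shows "locally_integrable \<Omega> u"
  unfolding locally_integrable_def
proof safe
  fix K :: "(real ^ 'n) set" assume K: "compact K"
  have "integrable lborel (\<lambda>x. indicator K x *\<^sub>R u x)"
    using K assms by (intro borel_integrable_compact) (auto intro: continuous_on_subset)
  then show "u absolutely_integrable_on K"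
    unfolding set_integrable_def by (subst integrable_completion) auto
qed

lemma is_weak_grad_diff:
  assumes \<Omega>: "open \<Omega>" and f: "is_weak_grad \<Omega> f F" and g: "is_weak_grad \<Omega> g G"
  shows "is_weak_grad \<Omega> (\<lambda>x. f x - g x) (\<lambda>x. F x - G x)"
  unfolding is_weak_grad_def
proof (intro conjI allI impI)
  show "locally_integrable \<Omega> (\<lambda>x. f x - g x)"
    using f g by (auto simp: is_weak_grad_def intro: locally_integrable_diff)
  show "locally_integrable \<Omega> (\<lambda>x. (F x - G x) $ h)" for h
    using f g by (auto simp: is_weak_grad_def intro: locally_integrable_diff)
  fix \<phi> h assume \<phi>: "test_function \<Omega> \<phi>"
  note i = integrable_locally_integrable_test_function[OF \<Omega>]
  note D = test_function_partial_deriv[OF \<phi>, of h]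
  have li: "locally_integrable \<Omega> f" "locally_integrable \<Omega> g"
    "locally_integrable \<Omega> (\<lambda>x. F x $ h)" "locally_integrable \<Omega> (\<lambda>x. G x $ h)"
    using f g by (simp_all add: is_weak_grad_def)
  note ii = i[OF li(1) D] i[OF li(2) D] i[OF li(3) \<phi>] i[OF li(4) \<phi>]
  have "(LINT x|lebesgue_on \<Omega>. f x * partial_deriv h \<phi> x) = - (LINT x|lebesgue_on \<Omega>. F x $ h * \<phi> x)"
    "(LINT x|lebesgue_on \<Omega>. g x * partial_deriv h \<phi> x) = - (LINT x|lebesgue_on \<Omega>. G x $ h * \<phi> x)"
    using f g \<phi> by (simp_all add: is_weak_grad_def)
  then show "(LINT x|lebesgue_on \<Omega>. (f x - g x) * partial_deriv h \<phi> x) =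
      - (LINT x|lebesgue_on \<Omega>. (F x - G x) $ h * \<phi> x)"
    using ii by (simp add: left_diff_distrib)
qed

lemma is_weak_grad_unique:
  assumes \<Omega>: "open \<Omega>" and F: "is_weak_grad \<Omega> f F" and G: "is_weak_grad \<Omega> f G"
  shows "AE x in lebesgue_on \<Omega>. F x = G x"
proof -
  have *: "is_weak_grad \<Omega> (\<lambda>x. f x - f x) (\<lambda>x. F x - G x)"
    by (rule is_weak_grad_diff[OF \<Omega> F G])
  have "AE x in lebesgue_on \<Omega>. (F x - G x) $ h = 0" for h
    using * by (intro fundamental_lemma_calculus_of_variations[OF \<Omega>]) (auto simp: is_weak_grad_def)
  then have "AE x in lebesgue_on \<Omega>. \<forall>h\<in>UNIV. (F x - G x) $ h = 0"
    by (intro AE_finite_allI) auto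
  then show ?thesis
    by eventually_elim (simp add: vec_eq_iff)
qed

lemma is_weak_grad_weak_grad: "is_weak_grad \<Omega> f g \<Longrightarrow> is_weak_grad \<Omega> f (weak_grad \<Omega> f)"
  unfolding weak_grad_def by (rule someI[of "is_weak_grad \<Omega> f"])

text \<open>
  This replaces the arbitrary choice in the definition of the weak gradient by any weak gradient that can be computed.
\<close>

lemma weak_grad_AE_eq:
  "open \<Omega> \<Longrightarrow> is_weak_grad \<Omega> f g \<Longrightarrow> AE x in lebesgue_on \<Omega>. weak_grad \<Omega> f x = g x"
  by (rule is_weak_grad_unique[OF _ is_weak_grad_weak_grad])

lemma is_weak_grad_classical:
  assumes "open \<Omega>" "\<And>x. u differentiable (at x)" "\<And>h. continuous_on UNIV (partial_deriv h u)"
  shows "is_weak_grad \<Omega> u (\<lambda>x. \<chi> h. partial_deriv h u x)"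
proof -
  have "continuous_on UNIV u"
    using assms(2) by (simp add: continuous_on_eq_continuous_at differentiable_imp_continuous_within)
  then have "locally_integrable \<Omega> u" by (rule locally_integrable_continuous)
  moreover have "locally_integrable \<Omega> (partial_deriv h u)" for h
    by (rule locally_integrable_continuous[OF assms(3)])
  ultimately show ?thesis
    unfolding is_weak_grad_def using integration_by_parts[OF assms(1) _ assms(2,3)] by simp
qed

lemma is_weak_grad_smooth:
  assumes "open \<Omega>" "smooth u"
  shows "is_weak_grad \<Omega> u (\<lambda>x. \<chi> h. partial_deriv h u x)"
  by (intro is_weak_grad_classical assms smooth_differentiable
      Ck_continuous[OF smooth_partial_deriv[OF assms(2), rule_format, of 0]])

section \<open>Square integrable functions\<close>

lemma borel_measurable_lebesgue_on_AE_eq: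
  fixes f g :: "'a::euclidean_space \<Rightarrow> 'b::euclidean_space"
  assumes \<Omega>: "open \<Omega>" and f: "f \<in> borel_measurable (lebesgue_on \<Omega>)"
    and eq: "AE x in lebesgue_on \<Omega>. f x = g x"
  shows "g \<in> borel_measurable (lebesgue_on \<Omega>)"
proof -
  have S: "\<Omega> \<in> sets lebesgue" using \<Omega> by simp
  have "AE x in lebesgue. x \<in> \<Omega> \<longrightarrow> f x = g x"
    using eq S by (simp add: AE_restrict_space_iff)
  then have "AE x in lebesgue. (if x \<in> \<Omega> then f x else 0) = (if x \<in> \<Omega> then g x else 0)"
    by eventually_elim simp
  from borel_measurable_AE[OF borel_measurable_if_I[OF f S] this]
  show ?thesis by (rule borel_measurable_if_D)
qed

lemma integrable_if_abs_le:
  fixes f :: "'a::euclidean_space \<Rightarrow> real"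
  assumes "integrable M g" "f \<in> borel_measurable M" "\<And>x. \<bar>f x\<bar> \<le> g x"
  shows "integrable M f"
  using assms by (intro Bochner_Integration.integrable_bound[OF assms(1,2)])
    (auto intro: order_trans[OF _ abs_ge_self])

lemma square_integrable_norm_mult:
  fixes f :: "real ^ 'n::finite \<Rightarrow> 'b::euclidean_space" and g :: "real ^ 'n \<Rightarrow> 'c::euclidean_space"
  assumes "square_integrable \<Omega> f" "square_integrable \<Omega> g"
  shows "integrable (lebesgue_on \<Omega>) (\<lambda>x. norm (f x) * norm (g x))"
proof (rule integrable_if_abs_le)
  show "integrable (lebesgue_on \<Omega>) (\<lambda>x. (norm (f x))\<^sup>2 + (norm (g x))\<^sup>2)"
    using assms by (auto simp: square_integrable_def)
  show "(\<lambda>x. norm (f x) * norm (g x)) \<in> borel_measurable (lebesgue_on \<Omega>)"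
    using assms by (auto simp: square_integrable_def)
  have "2 * (norm (f x) * norm (g x)) \<le> (norm (f x))\<^sup>2 + (norm (g x))\<^sup>2" for x
    using sum_squares_bound[of "norm (f x)" "norm (g x)"] by (simp add: mult.assoc)
  moreover have "0 \<le> norm (f x) * norm (g x)" for x by simp
  ultimately show "\<bar>norm (f x) * norm (g x)\<bar> \<le> (norm (f x))\<^sup>2 + (norm (g x))\<^sup>2" for x
    by (smt (verit))
qed

lemma integrable_square_integrable_bound:
  fixes f :: "real ^ 'n::finite \<Rightarrow> 'b::euclidean_space" and g :: "real ^ 'n \<Rightarrow> 'c::euclidean_space"
    and u :: "real ^ 'n \<Rightarrow> real"
  assumes "square_integrable \<Omega> f" "square_integrable \<Omega> g"
    "u \<in> borel_measurable (lebesgue_on \<Omega>)" "\<And>x. \<bar>u x\<bar> \<le> C * (norm (f x) * norm (g x))"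
  shows "integrable (lebesgue_on \<Omega>) u"
proof (rule integrable_if_abs_le)
  show "integrable (lebesgue_on \<Omega>) (\<lambda>x. C * (norm (f x) * norm (g x)))"
    using square_integrable_norm_mult[OF assms(1,2)] by (rule integrable_mult_right)
qed (rule assms)+

lemma square_integrable_bound:
  fixes f :: "real ^ 'n::finite \<Rightarrow> 'b::euclidean_space" and u :: "real ^ 'n \<Rightarrow> 'c::euclidean_space"
  assumes "square_integrable \<Omega> f" "u \<in> borel_measurable (lebesgue_on \<Omega>)" "\<And>x. norm (u x) \<le> C * norm (f x)"
  shows "square_integrable \<Omega> u"
  unfolding square_integrable_def
proof
  show "integrable (lebesgue_on \<Omega>) (\<lambda>x. (norm (u x))\<^sup>2)"
  proof (rule integrable_if_abs_le)
    show "integrable (lebesgue_on \<Omega>) (\<lambda>x. C\<^sup>2 * (norm (f x))\<^sup>2)"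
      using assms(1) by (auto simp: square_integrable_def)
    show "\<bar>(norm (u x))\<^sup>2\<bar> \<le> C\<^sup>2 * (norm (f x))\<^sup>2" for x
      using power_mono[OF assms(3), of x 2] by (simp add: power_mult_distrib)
  qed (use assms in auto)
qed (rule assms)

lemma square_integrable_add:
  fixes f g :: "real ^ 'n::finite \<Rightarrow> 'b::euclidean_space"
  assumes "square_integrable \<Omega> f" "square_integrable \<Omega> g"
  shows "square_integrable \<Omega> (\<lambda>x. f x + g x)"
  unfolding square_integrable_def
proof
  show "integrable (lebesgue_on \<Omega>) (\<lambda>x. (norm (f x + g x))\<^sup>2)"
  proof (rule integrable_if_abs_le)
    show "integrable (lebesgue_on \<Omega>) (\<lambda>x. 2 * (norm (f x))\<^sup>2 + 2 * (norm (g x))\<^sup>2)"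
      using assms by (auto simp: square_integrable_def)
    have "(norm (f x + g x))\<^sup>2 \<le> (norm (f x) + norm (g x))\<^sup>2" for x
      by (intro power_mono norm_triangle_ineq) simp
    moreover have "(norm (f x) + norm (g x))\<^sup>2 \<le> 2 * (norm (f x))\<^sup>2 + 2 * (norm (g x))\<^sup>2" for x
      using sum_squares_bound[of "norm (f x)" "norm (g x)"] by (simp add: power2_sum)
    ultimately show "\<bar>(norm (f x + g x))\<^sup>2\<bar> \<le> 2 * (norm (f x))\<^sup>2 + 2 * (norm (g x))\<^sup>2" for x
      by (metis abs_of_nonneg zero_le_power2 order_trans)
  qed (use assms in \<open>auto simp: square_integrable_def\<close>)
qed (use assms in \<open>auto simp: square_integrable_def\<close>)

lemma square_integrable_diff:
  fixes f g :: "real ^ 'n::finite \<Rightarrow> 'b::euclidean_space"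
  assumes "square_integrable \<Omega> f" "square_integrable \<Omega> g"
  shows "square_integrable \<Omega> (\<lambda>x. f x - g x)"
proof -
  have "square_integrable \<Omega> (\<lambda>x. - g x)"
    using assms(2) by (auto simp: square_integrable_def)
  from square_integrable_add[OF assms(1) this] show ?thesis by simp
qed

lemma square_integrable_AE_eq:
  fixes f g :: "real ^ 'n::finite \<Rightarrow> 'b::euclidean_space"
  assumes \<Omega>: "open \<Omega>" and f: "square_integrable \<Omega> f" and eq: "AE x in lebesgue_on \<Omega>. f x = g x"
  shows "square_integrable \<Omega> g"
  unfolding square_integrable_def
proof
  show g: "g \<in> borel_measurable (lebesgue_on \<Omega>)"
    using borel_measurable_lebesgue_on_AE_eq[OF \<Omega> _ eq] f by (auto simp: square_integrable_def)
  show "integrable (lebesgue_on \<Omega>) (\<lambda>x. (norm (g x))\<^sup>2)"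
  proof (rule integrable_cong_AE_imp)
    show "integrable (lebesgue_on \<Omega>) (\<lambda>x. (norm (f x))\<^sup>2)"
      using f by (simp add: square_integrable_def)
    show "AE x in lebesgue_on \<Omega>. (norm (f x))\<^sup>2 = (norm (g x))\<^sup>2"
      using eq by eventually_elim simp
  qed (use g in measurable)
qed

lemma square_integrable_continuous:
  fixes u :: "real ^ 'n::finite \<Rightarrow> 'b::euclidean_space"
  assumes \<Omega>: "open \<Omega>" and u: "continuous_on UNIV u" and K: "compact K" "\<And>x. x \<notin> K \<Longrightarrow> u x = 0"
  shows "square_integrable \<Omega> u"
  unfolding square_integrable_def
proof
  show m: "u \<in> borel_measurable (lebesgue_on \<Omega>)"
    by (intro measurable_restrict_space1 borel_measurable_lebesgue_continuous u)
  have "integrable lborel (\<lambda>x. (norm (u x))\<^sup>2)"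
    using K by (intro integrable_continuous_compact_support[of _ K] continuous_intros u) auto
  then have "integrable lebesgue (\<lambda>x. (norm (u x))\<^sup>2)"
    by (subst integrable_completion) auto
  then have "integrable lebesgue (\<lambda>x. indicator \<Omega> x *\<^sub>R (norm (u x))\<^sup>2)"
    using \<Omega> by (intro integrable_mult_indicator) auto
  then show "integrable (lebesgue_on \<Omega>) (\<lambda>x. (norm (u x))\<^sup>2)"
    using \<Omega> by (subst integrable_restrict_space) auto
qed

lemma square_integrable_indicator_compact:
  assumes "open \<Omega>" "compact (K :: (real ^ 'n::finite) set)"
  shows "square_integrable \<Omega> (indicat_real K)"
  unfolding square_integrable_def
proof
  have K: "K \<in> sets lebesgue"
    using assms by (simp add: borel_compact)
  then show "indicat_real K \<in> borel_measurable (lebesgue_on \<Omega>)"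
    by (intro measurable_restrict_space1 borel_measurable_indicator)
  have "emeasure lborel K < \<infinity>"
    using assms by (intro emeasure_compact_finite)
  then have "integrable lborel (indicat_real K)"
    using assms by (intro integrable_real_indicator) (auto simp: borel_compact)
  then have "integrable lebesgue (indicat_real K)"
    using assms by (subst integrable_completion) (auto simp: borel_compact)
  then have "integrable lebesgue (\<lambda>x. indicator \<Omega> x *\<^sub>R indicat_real K x)"
    using assms by (intro integrable_mult_indicator) auto
  then have "integrable (lebesgue_on \<Omega>) (indicat_real K)"
    using assms by (subst integrable_restrict_space) auto
  moreover have "(\<lambda>x. (norm (indicat_real K x))\<^sup>2) = indicat_real K"
    by (auto simp: indicator_def fun_eq_iff)
  ultimately show "integrable (lebesgue_on \<Omega>) (\<lambda>x. (norm (indicat_real K x))\<^sup>2)"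
    by simp
qed

lemma square_integrable_imp_locally_integrable:
  assumes \<Omega>: "open \<Omega>" and f: "square_integrable \<Omega> f"
  shows "locally_integrable \<Omega> f"
  unfolding locally_integrable_def
proof safe
  fix K assume K: "compact K" "K \<subseteq> \<Omega>"
  have "integrable (lebesgue_on \<Omega>) (\<lambda>x. indicator K x * f x)"
    using f square_integrable_indicator_compact[OF \<Omega> K(1)]
    by (intro integrable_square_integrable_bound[OF square_integrable_indicator_compact[OF \<Omega> K(1)] f, of _ 1])
       (auto simp: square_integrable_def abs_mult)
  then have "integrable lebesgue (\<lambda>x. indicator \<Omega> x *\<^sub>R (indicator K x * f x))"
    using \<Omega> by (subst (asm) integrable_restrict_space) auto
  moreover have "(\<lambda>x. indicator \<Omega> x *\<^sub>R (indicator K x * f x)) = (\<lambda>x. indicator K x *\<^sub>R f x)"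
    using K by (auto simp: indicator_def fun_eq_iff)
  ultimately show "f absolutely_integrable_on K"
    by (simp add: set_integrable_def)
qed


section \<open>Symmetry of second derivatives\<close>

lemma partial_deriv_shift:
  assumes "\<And>x. f differentiable (at x)"
  shows "(\<lambda>z. f (z + c)) differentiable (at x)"
    and "partial_deriv h (\<lambda>z. f (z + c)) x = partial_deriv h f (x + c)"
proof -
  have "((\<lambda>z. z + c) has_derivative (\<lambda>y. y)) (at x)"
    by (auto intro!: derivative_eq_intros)
  moreover have "(f has_derivative frechet_derivative f (at (x + c))) (at (x + c))"
    using assms frechet_derivative_works by blast
  ultimately have *: "((\<lambda>z. f (z + c)) has_derivative frechet_derivative f (at (x + c))) (at x)"
    by (rule has_derivative_compose)
  then show "(\<lambda>z. f (z + c)) differentiable (at x)"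
    by (rule differentiableI)
  show "partial_deriv h (\<lambda>z. f (z + c)) x = partial_deriv h f (x + c)"
    unfolding partial_deriv_eq[OF *] by (simp add: partial_deriv_def)
qed

text \<open>
  Two applications of the mean value theorem, first to the difference of \<open>f\<close> in direction
  \<open>k\<close>, regarded as a function that is then differenced in direction \<open>h\<close>.
\<close>

lemma second_difference_eq_mixed_partial:
  fixes f :: "real ^ 'n::finite \<Rightarrow> real"
  assumes f: "smooth f" and t: "0 < t"
  obtains y where "norm (y - x) \<le> 2 * t"
    "f (x + t *\<^sub>R axis h 1 + t *\<^sub>R axis k 1) - f (x + t *\<^sub>R axis h 1) - f (x + t *\<^sub>R axis k 1) + f x
      = t\<^sup>2 * partial_deriv k (partial_deriv h f) y"
proof -
  \<comment> \<open>The second difference of \<open>f\<close> is the difference of \<open>g\<close> in direction \<open>h\<close>.\<close>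
  define g where "g z = f (z + t *\<^sub>R axis k 1) - f z" for z
  note df = smooth_differentiable[OF f]
  note sh = partial_deriv_shift[of f, OF df]
  have dg: "g differentiable (at z)" for z
    unfolding g_def by (intro differentiable_diff sh df)
  have Dg: "partial_deriv h g z = partial_deriv h f (z + t *\<^sub>R axis k 1) - partial_deriv h f z" for z
    unfolding g_def by (simp add: partial_deriv_diff[OF sh(1) df] sh(2))
  obtain a where a: "0 < a" "a < t" "g (x + t *\<^sub>R axis h 1) - g x = t * partial_deriv h g (x + a *\<^sub>R axis h 1)"
    by (rule partial_deriv_mean_value[OF dg t, of x h])
  obtain b where b: "0 < b" "b < t"
    "partial_deriv h f (x + a *\<^sub>R axis h 1 + t *\<^sub>R axis k 1) - partial_deriv h f (x + a *\<^sub>R axis h 1) =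
      t * partial_deriv k (partial_deriv h f) (x + a *\<^sub>R axis h 1 + b *\<^sub>R axis k 1)"
    by (rule partial_deriv_mean_value[OF smooth_differentiable[OF smooth_partial_deriv[OF f]] t,
          of h "x + a *\<^sub>R axis h 1" k])
  have "norm (a *\<^sub>R axis h 1 + b *\<^sub>R axis k (1::real)) \<le> \<bar>a\<bar> + \<bar>b\<bar>"
    by (rule order_trans[OF norm_triangle_ineq]) (simp add: norm_axis_1)
  then have n: "norm ((x + a *\<^sub>R axis h 1 + b *\<^sub>R axis k 1) - x) \<le> 2 * t"
    using a b by (simp add: add.assoc)
  have "f (x + t *\<^sub>R axis h 1 + t *\<^sub>R axis k 1) - f (x + t *\<^sub>R axis h 1) - f (x + t *\<^sub>R axis k 1) + f x =
      g (x + t *\<^sub>R axis h 1) - g x"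
    by (simp add: g_def)
  also have "\<dots> = t\<^sup>2 * partial_deriv k (partial_deriv h f) (x + a *\<^sub>R axis h 1 + b *\<^sub>R axis k 1)"
    unfolding a(3) Dg b(3) by (simp add: power2_eq_square)
  finally show ?thesis by (rule that[OF n])
qed

text \<open>
  The second difference is symmetric in the two directions, so both mixed derivatives take a common value at points
  that converge to \<open>x\<close>.
\<close>

lemma partial_deriv_commute:
  fixes f :: "real ^ 'n::finite \<Rightarrow> real"
  assumes f: "smooth f"
  shows "partial_deriv k (partial_deriv h f) x = partial_deriv h (partial_deriv k f) x"
proof -
  define t where "t n = 1 / real (Suc n)" for n
  have t: "0 < t n" for n by (simp add: t_def)
  have t0: "t \<longlonglongrightarrow> 0"
    unfolding t_def using LIMSEQ_Suc lim_1_over_n by blast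
  have "\<exists>y z. norm (y - x) \<le> 2 * t n \<and> norm (z - x) \<le> 2 * t n \<and>
      partial_deriv k (partial_deriv h f) y = partial_deriv h (partial_deriv k f) z" for n
  proof -
    obtain y where y: "norm (y - x) \<le> 2 * t n"
      "f (x + t n *\<^sub>R axis h 1 + t n *\<^sub>R axis k 1) - f (x + t n *\<^sub>R axis h 1) - f (x + t n *\<^sub>R axis k 1) + f x
        = (t n)\<^sup>2 * partial_deriv k (partial_deriv h f) y"
      by (rule second_difference_eq_mixed_partial[OF f t])
    obtain z where z: "norm (z - x) \<le> 2 * t n"
      "f (x + t n *\<^sub>R axis k 1 + t n *\<^sub>R axis h 1) - f (x + t n *\<^sub>R axis k 1) - f (x + t n *\<^sub>R axis h 1) + f x
        = (t n)\<^sup>2 * partial_deriv h (partial_deriv k f) z"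
      by (rule second_difference_eq_mixed_partial[OF f t])
    have swap: "x + t n *\<^sub>R axis k 1 + t n *\<^sub>R axis h 1 = x + t n *\<^sub>R axis h 1 + t n *\<^sub>R axis k 1"
      by simp
    have "(t n)\<^sup>2 * partial_deriv k (partial_deriv h f) y = (t n)\<^sup>2 * partial_deriv h (partial_deriv k f) z"
      using y(2) z(2)[unfolded swap] by linarith
    then have "partial_deriv k (partial_deriv h f) y = partial_deriv h (partial_deriv k f) z"
      using t[of n] by simp
    with y(1) z(1) show ?thesis by (intro exI conjI)
  qed
  then obtain y z where yz: "\<And>n. norm (y n - x) \<le> 2 * t n" "\<And>n. norm (z n - x) \<le> 2 * t n"
    "\<And>n. partial_deriv k (partial_deriv h f) (y n) = partial_deriv h (partial_deriv k f) (z n)"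
    by metis
  have lim: "w \<longlonglongrightarrow> x" if "\<And>n. norm (w n - x) \<le> 2 * t n" for w
  proof -
    have "(\<lambda>n. 2 * t n) \<longlonglongrightarrow> 0"
      using tendsto_mult_right_zero[OF t0] by simp
    then have "(\<lambda>n. w n - x) \<longlonglongrightarrow> 0"
      by (rule Lim_null_comparison[rotated]) (simp add: that)
    then show ?thesis by (simp add: LIM_zero_iff)
  qed
  have c: "isCont (partial_deriv i (partial_deriv j f)) x" for i j
    using Ck_continuous[OF smooth_partial_deriv[OF smooth_partial_deriv[OF f], rule_format, of 0]]
    by (simp add: continuous_on_eq_continuous_at)
  have "(\<lambda>n. partial_deriv k (partial_deriv h f) (y n)) \<longlonglongrightarrow> partial_deriv k (partial_deriv h f) x"
    by (rule isCont_tendsto_compose[OF c lim[OF yz(1)]])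
  moreover have "(\<lambda>n. partial_deriv h (partial_deriv k f) (z n)) \<longlonglongrightarrow> partial_deriv h (partial_deriv k f) x"
    by (rule isCont_tendsto_compose[OF c lim[OF yz(2)]])
  ultimately show ?thesis
    unfolding yz(3) by (rule LIMSEQ_unique)
qed

section \<open>Approximation by test fields\<close>

lemma measurable_vec_nth:
  "f \<in> borel_measurable M \<Longrightarrow> (\<lambda>x. (f x :: 'b::euclidean_space ^ 'm::finite) $ i) \<in> borel_measurable M"
  by (rule measurable_compose[where g = "\<lambda>w. w $ i", OF _ borel_measurable_continuous_onI])
    (simp_all add: continuous_on_component)

lemma measurable_vecI:
  fixes f :: "'a \<Rightarrow> 'b::euclidean_space ^ 'm::finite"
  assumes "\<And>i. (\<lambda>x. f x $ i) \<in> borel_measurable M"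
  shows "f \<in> borel_measurable M"
proof (subst borel_measurable_euclidean_space, intro ballI)
  fix b :: "'b ^ 'm" assume "b \<in> Basis"
  then obtain i u where b: "b = axis i u" by (auto simp: Basis_vec_def)
  show "(\<lambda>x. f x \<bullet> b) \<in> borel_measurable M"
    unfolding b inner_axis by (intro borel_measurable_inner assms borel_measurable_const)
qed

lemma norm_vec_power2: "(norm (x :: 'b::euclidean_space ^ 'm::finite))\<^sup>2 = (\<Sum>i\<in>UNIV. (norm (x $ i))\<^sup>2)"
  by (simp add: power2_norm_eq_inner inner_vec_def)

lemma square_integrable_vec:
  fixes f :: "real ^ 'n::finite \<Rightarrow> 'b::euclidean_space ^ 'm::finite"
  assumes "\<And>i. square_integrable \<Omega> (\<lambda>x. f x $ i)"
  shows "square_integrable \<Omega> f"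
  unfolding square_integrable_def norm_vec_power2
  using assms by (intro conjI measurable_vecI Bochner_Integration.integrable_sum)
    (simp_all add: square_integrable_def)

definition classical_jacobian :: "(real ^ 'n::finite \<Rightarrow> real ^ 'n) \<Rightarrow> real ^ 'n \<Rightarrow> real ^ 'n ^ 'n"
  where "classical_jacobian \<phi> x = (\<chi> \<alpha> h. partial_deriv h (\<lambda>y. \<phi> y $ \<alpha>) x)"

lemma square_integrable_test_function:
  assumes "open \<Omega>" "test_function \<Omega> \<phi>"
  shows "square_integrable \<Omega> \<phi>"
proof -
  obtain K where "compact K" "\<And>x. x \<notin> K \<Longrightarrow> \<phi> x = 0"
    using test_function_support[OF assms(2)] by metis
  then show ?thesis
    by (rule square_integrable_continuous[OF assms(1)
        Ck_continuous[OF test_function_smooth[OF assms(2), rule_format, of 0]]])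
qed

lemma square_integrable_test_field:
  assumes "open \<Omega>" "test_field \<Omega> \<phi>"
  shows "square_integrable \<Omega> \<phi>" "square_integrable \<Omega> (classical_jacobian \<phi>)"
proof -
  have t: "test_function \<Omega> (\<lambda>x. \<phi> x $ \<alpha>)" for \<alpha>
    using assms(2) by (simp add: test_field_def)
  show "square_integrable \<Omega> \<phi>"
    by (intro square_integrable_vec square_integrable_test_function assms t)
  show "square_integrable \<Omega> (classical_jacobian \<phi>)"
    by (intro square_integrable_vec) (simp add: classical_jacobian_def
        square_integrable_test_function[OF assms(1) test_function_partial_deriv[OF t]])
qed

text \<open>
  The chosen weak Jacobian agrees almost everywhere with a square integrable one, and Lebesgue measure is complete, so
  it is itself measurable and square integrable.
\<close>

lemma W12_weak_jacobian:
  assumes \<Omega>: "open \<Omega>" and v: "v \<in> W12 \<Omega>"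
  shows "square_integrable \<Omega> v" "square_integrable \<Omega> (weak_jacobian \<Omega> v)"
    "is_weak_grad \<Omega> (\<lambda>y. v y $ \<alpha>) (\<lambda>x. weak_jacobian \<Omega> v x $ \<alpha>)"
proof -
  show "square_integrable \<Omega> v" using v by (simp add: W12_def)
  have ex: "\<exists>g. is_weak_grad \<Omega> (\<lambda>y. v y $ \<alpha>) g \<and> square_integrable \<Omega> g" for \<alpha>
    using v by (simp add: W12_def)
  have w: "is_weak_grad \<Omega> (\<lambda>y. v y $ \<alpha>) (weak_grad \<Omega> (\<lambda>y. v y $ \<alpha>)) \<and>
      square_integrable \<Omega> (weak_grad \<Omega> (\<lambda>y. v y $ \<alpha>))" for \<alpha>
  proof -
    obtain g where g: "is_weak_grad \<Omega> (\<lambda>y. v y $ \<alpha>) g" "square_integrable \<Omega> g"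
      using ex by blast
    have "AE x in lebesgue_on \<Omega>. g x = weak_grad \<Omega> (\<lambda>y. v y $ \<alpha>) x"
      using weak_grad_AE_eq[OF \<Omega> g(1)] by eventually_elim simp
    from square_integrable_AE_eq[OF \<Omega> g(2) this] is_weak_grad_weak_grad[OF g(1)]
    show ?thesis by simp
  qed
  show "square_integrable \<Omega> (weak_jacobian \<Omega> v)"
    by (rule square_integrable_vec) (simp add: weak_jacobian_def w)
  show "is_weak_grad \<Omega> (\<lambda>y. v y $ \<alpha>) (\<lambda>x. weak_jacobian \<Omega> v x $ \<alpha>)"
    by (simp add: weak_jacobian_def w)
qed

text \<open>
  The norm in the definition of the space is built from the weak Jacobian chosen for the difference \<open>v -
  \<phi>\<close>; almost everywhere this is the difference of the weak Jacobian of \<open>v\<close> and the classical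
  Jacobian of \<open>\<phi>\<close>.
\<close>

lemma W12_0_approx:
  assumes \<Omega>: "open \<Omega>" and v: "v \<in> W12_0 \<Omega>" and e: "0 < e"
  obtains \<phi> where "test_field \<Omega> \<phi>"
    "(LINT x|lebesgue_on \<Omega>. (norm (v x - \<phi> x))\<^sup>2) +
     (LINT x|lebesgue_on \<Omega>. (norm (weak_jacobian \<Omega> v x - classical_jacobian \<phi> x))\<^sup>2) < e"
proof -
  have W: "v \<in> W12 \<Omega>" using v by (simp add: W12_0_def)
  note G = W12_weak_jacobian[OF \<Omega> W]
  have "0 < sqrt e" using e by simp
  then obtain \<phi> where \<phi>: "test_field \<Omega> \<phi>" "W12_norm \<Omega> (\<lambda>x. v x - \<phi> x) < sqrt e"
    using v unfolding W12_0_def by blast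
  have t: "test_function \<Omega> (\<lambda>x. \<phi> x $ \<alpha>)" for \<alpha>
    using \<phi>(1) by (simp add: test_field_def)
  have "AE x in lebesgue_on \<Omega>. weak_jacobian \<Omega> (\<lambda>x. v x - \<phi> x) x $ \<alpha> = (weak_jacobian \<Omega> v x - classical_jacobian \<phi> x) $ \<alpha>" for \<alpha>
  proof -
    have "is_weak_grad \<Omega> (\<lambda>y. v y $ \<alpha> - \<phi> y $ \<alpha>) (\<lambda>x. weak_jacobian \<Omega> v x $ \<alpha> - (\<chi> h. partial_deriv h (\<lambda>y. \<phi> y $ \<alpha>) x))"
      by (rule is_weak_grad_diff[OF \<Omega> G(3) is_weak_grad_smooth[OF \<Omega> test_function_smooth[OF t]]])
    from weak_grad_AE_eq[OF \<Omega> this] show ?thesis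
      by (simp add: weak_jacobian_def classical_jacobian_def)
  qed
  then have "AE x in lebesgue_on \<Omega>. \<forall>\<alpha>\<in>UNIV. weak_jacobian \<Omega> (\<lambda>x. v x - \<phi> x) x $ \<alpha> = (weak_jacobian \<Omega> v x - classical_jacobian \<phi> x) $ \<alpha>"
    by (intro AE_finite_allI) auto
  then have eq: "AE x in lebesgue_on \<Omega>. weak_jacobian \<Omega> v x - classical_jacobian \<phi> x = weak_jacobian \<Omega> (\<lambda>x. v x - \<phi> x) x"
    by eventually_elim (simp add: vec_eq_iff)
  have s: "square_integrable \<Omega> (\<lambda>x. weak_jacobian \<Omega> v x - classical_jacobian \<phi> x)"
    by (rule square_integrable_diff[OF G(2) square_integrable_test_field(2)[OF \<Omega> \<phi>(1)]])
  have s': "square_integrable \<Omega> (weak_jacobian \<Omega> (\<lambda>x. v x - \<phi> x))"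
    by (rule square_integrable_AE_eq[OF \<Omega> s eq])
  have "(LINT x|lebesgue_on \<Omega>. (norm (weak_jacobian \<Omega> (\<lambda>x. v x - \<phi> x) x))\<^sup>2) =
      (LINT x|lebesgue_on \<Omega>. (norm (weak_jacobian \<Omega> v x - classical_jacobian \<phi> x))\<^sup>2)"
  proof (rule integral_cong_AE)
    show "AE x in lebesgue_on \<Omega>. (norm (weak_jacobian \<Omega> (\<lambda>x. v x - \<phi> x) x))\<^sup>2 =
        (norm (weak_jacobian \<Omega> v x - classical_jacobian \<phi> x))\<^sup>2"
      using eq by eventually_elim simp
  qed (use s s' in \<open>auto simp: square_integrable_def\<close>)
  then show ?thesis
    using \<phi> by (intro that) (simp_all add: W12_norm_def)
qed

text \<open>
  The common density argument for the two integral identities below: an integrand in \<open>v\<close> and its Jacobian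
  integrates to \<open>0\<close> if its counterpart for test fields does and if the two differ by at most a square
  integrable factor times the distance of the data. The difference is integrated by means of \<open>2 H y \<le> t
  H\<^sup>2 + y\<^sup>2 / t\<close>, where \<open>t\<close> is small and \<open>\<phi>\<close> is so close to
  \<open>v\<close> that the last term is small as well.
\<close>

lemma integral_eq_0_by_density:
  fixes I :: "real ^ 'n::finite \<Rightarrow> real" and H :: "real ^ 'n \<Rightarrow> real"
  assumes \<Omega>: "open \<Omega>" and v: "v \<in> W12_0 \<Omega>" and I: "integrable (lebesgue_on \<Omega>) I"
    and H: "square_integrable \<Omega> H"
    and J: "\<And>\<phi>. test_field \<Omega> \<phi> \<Longrightarrow> integrable (lebesgue_on \<Omega>) (J \<phi>)"
      "\<And>\<phi>. test_field \<Omega> \<phi> \<Longrightarrow> (LINT x|lebesgue_on \<Omega>. J \<phi> x) = 0"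
    and IJ: "\<And>\<phi> x. test_field \<Omega> \<phi> \<Longrightarrow> \<bar>I x - J \<phi> x\<bar> \<le>
        H x * (norm (v x - \<phi> x) + norm (weak_jacobian \<Omega> v x - classical_jacobian \<phi> x))"
  shows "(LINT x|lebesgue_on \<Omega>. I x) = 0"
proof (rule ccontr)
  define c where "c = \<bar>LINT x|lebesgue_on \<Omega>. I x\<bar>"
  define B where "B = (LINT x|lebesgue_on \<Omega>. (H x)\<^sup>2)"
  assume "(LINT x|lebesgue_on \<Omega>. I x) \<noteq> 0"
  then have c: "0 < c" by (simp add: c_def)
  have B: "0 \<le> B" by (simp add: B_def)
  have iH: "integrable (lebesgue_on \<Omega>) (\<lambda>x. (H x)\<^sup>2)"
    using H by (simp add: square_integrable_def)
  \<comment> \<open>With this choice the final estimate reads \<open>c < c / 2\<close>.\<close>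
  define t where "t = c / (2 * (B + 1))"
  have t: "0 < t" using c B by (simp add: t_def)
  have W: "v \<in> W12 \<Omega>" using v by (simp add: W12_0_def)
  note G = W12_weak_jacobian[OF \<Omega> W]
  have "0 < 2 * t\<^sup>2" using t by simp
  then obtain \<phi> where \<phi>: "test_field \<Omega> \<phi>" and small:
    "(LINT x|lebesgue_on \<Omega>. (norm (v x - \<phi> x))\<^sup>2) +
     (LINT x|lebesgue_on \<Omega>. (norm (weak_jacobian \<Omega> v x - classical_jacobian \<phi> x))\<^sup>2) < 2 * t\<^sup>2"
    by (rule W12_0_approx[OF \<Omega> v])
  define a where "a x = norm (v x - \<phi> x)" for x
  define b where "b x = norm (weak_jacobian \<Omega> v x - classical_jacobian \<phi> x)" for x
  have ia: "integrable (lebesgue_on \<Omega>) (\<lambda>x. (a x)\<^sup>2)"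
    using square_integrable_diff[OF G(1) square_integrable_test_field(1)[OF \<Omega> \<phi>]]
    by (simp add: square_integrable_def a_def)
  have ib: "integrable (lebesgue_on \<Omega>) (\<lambda>x. (b x)\<^sup>2)"
    using square_integrable_diff[OF G(2) square_integrable_test_field(2)[OF \<Omega> \<phi>]]
    by (simp add: square_integrable_def b_def)
  have young: "H x * y \<le> (t * (H x)\<^sup>2 + y\<^sup>2 / t) / 2" for x y
  proof -
    have "0 \<le> (t * H x - y)\<^sup>2 / t" using t by simp
    also have "\<dots> = t * (H x)\<^sup>2 + y\<^sup>2 / t - 2 * (H x * y)"
      using t by (simp add: power2_eq_square field_simps)
    finally show ?thesis by simp
  qed
  have pw: "\<bar>I x - J \<phi> x\<bar> \<le> t * (H x)\<^sup>2 + ((a x)\<^sup>2 + (b x)\<^sup>2) / (2 * t)" for x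
  proof -
    have "\<bar>I x - J \<phi> x\<bar> \<le> H x * a x + H x * b x"
      using IJ[OF \<phi>, of x] by (simp add: a_def b_def distrib_left)
    also have "\<dots> \<le> (t * (H x)\<^sup>2 + (a x)\<^sup>2 / t) / 2 + (t * (H x)\<^sup>2 + (b x)\<^sup>2 / t) / 2"
      by (intro add_mono young)
    also have "\<dots> = t * (H x)\<^sup>2 + ((a x)\<^sup>2 + (b x)\<^sup>2) / (2 * t)"
      using t by (simp add: field_simps)
    finally show ?thesis .
  qed
  have "c = \<bar>LINT x|lebesgue_on \<Omega>. I x - J \<phi> x\<bar>"
    using I J[OF \<phi>] by (simp add: c_def)
  also have "\<dots> \<le> (LINT x|lebesgue_on \<Omega>. \<bar>I x - J \<phi> x\<bar>)"
    by (rule integral_abs_bound)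
  also have "\<dots> \<le> (LINT x|lebesgue_on \<Omega>. t * (H x)\<^sup>2 + ((a x)\<^sup>2 + (b x)\<^sup>2) / (2 * t))"
    using I J(1)[OF \<phi>] iH ia ib pw by (intro integral_mono) auto
  also have "\<dots> = t * B + ((LINT x|lebesgue_on \<Omega>. (a x)\<^sup>2) + (LINT x|lebesgue_on \<Omega>. (b x)\<^sup>2)) / (2 * t)"
    using iH ia ib by (simp add: B_def)
  also have "\<dots> < t * B + 2 * t\<^sup>2 / (2 * t)"
    using small t by (intro add_strict_left_mono divide_strict_right_mono) (simp_all add: a_def b_def)
  also have "\<dots> = t * (B + 1)"
    using t by (simp add: power2_eq_square algebra_simps)
  also have "\<dots> = c / 2"
    using B by (simp add: t_def field_simps)
  finally show False using c by simp
qed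


section \<open>The null Lagrangian\<close>

text \<open>
  On the diagonal this is \<open>- 2\<close> times the sum of the principal two by two minors, a null Lagrangian. Its
  polarisation is needed because test fields are inserted into one argument only.
\<close>

definition minors_form :: "real ^ 'n ^ 'n \<Rightarrow> real ^ 'n ^ 'n \<Rightarrow> real"
  where "minors_form X Y = (\<Sum>\<alpha>\<in>UNIV. \<Sum>h\<in>UNIV. X $ \<alpha> $ h * Y $ h $ \<alpha> - X $ \<alpha> $ \<alpha> * Y $ h $ h)"

lemma minors_form_diff_right: "minors_form X (Y - Z) = minors_form X Y - minors_form X Z"
  by (simp add: minors_form_def right_diff_distrib sum_subtractf)

lemma matrix_component_le_norm: "\<bar>(X :: real ^ 'n::finite ^ 'm::finite) $ i $ j\<bar> \<le> norm X"
  by (rule order_trans[OF _ Finite_Cartesian_Product.norm_nth_le]) (use Finite_Cartesian_Product.norm_nth_le[of "X $ i" j] in simp)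

lemma abs_minors_form_le:
  fixes X Y :: "real ^ 'n::finite ^ 'n"
  shows "\<bar>minors_form X Y\<bar> \<le> 2 * (real CARD('n))\<^sup>2 * norm X * norm Y"
proof -
  have t: "\<bar>X $ \<alpha> $ h * Y $ h $ \<alpha> - X $ \<alpha> $ \<alpha> * Y $ h $ h\<bar> \<le> 2 * (norm X * norm Y)" for \<alpha> h
  proof -
    have m: "\<bar>X $ i $ j * Y $ k $ l\<bar> \<le> norm X * norm Y" for i j k l
      unfolding abs_mult by (intro mult_mono matrix_component_le_norm) auto
    show ?thesis
      using m[of \<alpha> h h \<alpha>] m[of \<alpha> \<alpha> h h] by linarith
  qed
  have "\<bar>minors_form X Y\<bar> \<le> (\<Sum>\<alpha>\<in>(UNIV::'n set). \<Sum>h\<in>(UNIV::'n set). 2 * (norm X * norm Y))"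
    unfolding minors_form_def by (intro order_trans[OF sum_abs] sum_mono t)
  then show ?thesis by (simp add: power2_eq_square mult.assoc mult.left_commute)
qed

text \<open>
  Moving the weak derivative of \<open>v\<close> onto the test field turns both terms of each minor into the integral
  of \<open>v\<^sub>\<alpha>\<close> against the same second derivative of \<open>\<phi>\<^sub>h\<close>, taken in the
  two orders.
\<close>

lemma integral_minors_form_test_field:
  assumes \<Omega>: "open \<Omega>" and G: "\<And>\<alpha>. is_weak_grad \<Omega> (\<lambda>y. v y $ \<alpha>) (\<lambda>x. G x $ \<alpha>)"
    and \<phi>: "test_field \<Omega> \<phi>"
  shows "integrable (lebesgue_on \<Omega>) (\<lambda>x. minors_form (G x) (classical_jacobian \<phi> x))"
    and "(LINT x|lebesgue_on \<Omega>. minors_form (G x) (classical_jacobian \<phi> x)) = 0"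
proof -
  have t: "test_function \<Omega> (\<lambda>x. \<phi> x $ \<alpha>)" for \<alpha>
    using \<phi> by (simp add: test_field_def)
  have li: "locally_integrable \<Omega> (\<lambda>x. G x $ \<alpha> $ h)" for \<alpha> h
    using G[of \<alpha>] by (simp add: is_weak_grad_def)
  have i: "integrable (lebesgue_on \<Omega>) (\<lambda>x. G x $ \<alpha> $ h * partial_deriv k (\<lambda>y. \<phi> y $ \<beta>) x)" for \<alpha> h k \<beta>
    by (rule integrable_locally_integrable_test_function[OF \<Omega> li test_function_partial_deriv[OF t]])
  have parts: "(LINT x|lebesgue_on \<Omega>. G x $ \<alpha> $ h * partial_deriv k (\<lambda>y. \<phi> y $ \<beta>) x) =
      - (LINT x|lebesgue_on \<Omega>. v x $ \<alpha> * partial_deriv h (partial_deriv k (\<lambda>y. \<phi> y $ \<beta>)) x)" for \<alpha> h k \<beta>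
    using G[of \<alpha>] test_function_partial_deriv[OF t, of k \<beta>] by (simp add: is_weak_grad_def)
  have swap: "(LINT x|lebesgue_on \<Omega>. G x $ \<alpha> $ h * partial_deriv \<alpha> (\<lambda>y. \<phi> y $ h) x) =
      (LINT x|lebesgue_on \<Omega>. G x $ \<alpha> $ \<alpha> * partial_deriv h (\<lambda>y. \<phi> y $ h) x)" for \<alpha> h
    unfolding parts partial_deriv_commute[OF test_function_smooth[OF t], of h \<alpha>] ..
  show "integrable (lebesgue_on \<Omega>) (\<lambda>x. minors_form (G x) (classical_jacobian \<phi> x))"
    unfolding minors_form_def classical_jacobian_def
    by (simp add: i)
  show "(LINT x|lebesgue_on \<Omega>. minors_form (G x) (classical_jacobian \<phi> x)) = 0"
    unfolding minors_form_def classical_jacobian_def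
    by (simp add: i Bochner_Integration.integral_sum Bochner_Integration.integral_diff swap)
qed

lemma integral_minors_form_eq_0:
  fixes v :: "real ^ 'n::finite \<Rightarrow> real ^ 'n"
  assumes \<Omega>: "open \<Omega>" and v: "v \<in> W12_0 \<Omega>"
  shows "integrable (lebesgue_on \<Omega>) (\<lambda>x. minors_form (weak_jacobian \<Omega> v x) (weak_jacobian \<Omega> v x))"
    and "(LINT x|lebesgue_on \<Omega>. minors_form (weak_jacobian \<Omega> v x) (weak_jacobian \<Omega> v x)) = 0"
proof -
  let ?G = "weak_jacobian \<Omega> v"
  let ?C = "2 * (real CARD('n))\<^sup>2"
  have W: "v \<in> W12 \<Omega>" using v by (simp add: W12_0_def)
  note G = W12_weak_jacobian[OF \<Omega> W]
  have Gm: "?G \<in> borel_measurable (lebesgue_on \<Omega>)"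
    using G(2) by (simp add: square_integrable_def)
  show i: "integrable (lebesgue_on \<Omega>) (\<lambda>x. minors_form (?G x) (?G x))"
  proof (rule integrable_square_integrable_bound[OF G(2) G(2)])
    show "(\<lambda>x. minors_form (?G x) (?G x)) \<in> borel_measurable (lebesgue_on \<Omega>)"
      unfolding minors_form_def
      by (intro borel_measurable_sum borel_measurable_diff borel_measurable_times measurable_vec_nth Gm)
    show "\<bar>minors_form (?G x) (?G x)\<bar> \<le> ?C * (norm (?G x) * norm (?G x))" for x
      using abs_minors_form_le[of "?G x" "?G x"] by (simp add: mult.assoc)
  qed
  show "(LINT x|lebesgue_on \<Omega>. minors_form (?G x) (?G x)) = 0"
  proof (rule integral_eq_0_by_density[OF \<Omega> v i])
    show "square_integrable \<Omega> (\<lambda>x. ?C * norm (?G x))"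
      using Gm by (intro square_integrable_bound[OF G(2), where C = ?C]) simp_all
    fix \<phi> :: "real ^ 'n \<Rightarrow> real ^ 'n" assume \<phi>: "test_field \<Omega> \<phi>"
    show "integrable (lebesgue_on \<Omega>) (\<lambda>x. minors_form (?G x) (classical_jacobian \<phi> x))"
      by (rule integral_minors_form_test_field(1)[OF \<Omega> G(3) \<phi>])
    show "(LINT x|lebesgue_on \<Omega>. minors_form (?G x) (classical_jacobian \<phi> x)) = 0"
      by (rule integral_minors_form_test_field(2)[OF \<Omega> G(3) \<phi>])
    show "\<bar>minors_form (?G x) (?G x) - minors_form (?G x) (classical_jacobian \<phi> x)\<bar> \<le>
        ?C * norm (?G x) * (norm (v x - \<phi> x) + norm (?G x - classical_jacobian \<phi> x))" for x
      unfolding minors_form_diff_right[symmetric]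
      by (rule order_trans[OF abs_minors_form_le]) (intro mult_left_mono, auto)
  qed
qed

section \<open>The weak gradient of the norm\<close>

lemma norm_column_le: "norm (column h X) \<le> norm (X :: real ^ 'n::finite ^ 'm::finite)"
proof (rule power2_le_imp_le)
  have "(X $ i $ h)\<^sup>2 \<le> (norm (X $ i))\<^sup>2" for i
    using power_mono[OF Finite_Cartesian_Product.norm_nth_le[of "X $ i" h], of 2] by simp
  then have "(\<Sum>i\<in>UNIV. (X $ i $ h)\<^sup>2) \<le> (\<Sum>i\<in>UNIV. (norm (X $ i))\<^sup>2)"
    by (intro sum_mono)
  then show "(norm (column h X))\<^sup>2 \<le> (norm X)\<^sup>2"
    unfolding norm_vec_power2[of X] norm_vec_power2[of "column h X"] by (simp add: column_def)
qed simp

lemma column_diff: "column h (X - Y) = column h X - column h (Y :: real ^ 'n ^ 'm)"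
  by (simp add: column_def vec_eq_iff)

lemma measurable_column:
  assumes "f \<in> borel_measurable M"
  shows "(\<lambda>x. column h (f x :: real ^ 'n::finite ^ 'm::finite)) \<in> borel_measurable M"
  by (rule measurable_vecI) (simp add: column_def measurable_vec_nth assms)

text \<open>
  The regularisation \<open>sqrt (norm w ^ 2 + d ^ 2)\<close> of the norm, smooth for \<open>d \<noteq> 0\<close>. As
  a norm on the product space it inherits the reverse triangle inequality, i.e. it is Lipschitz with constant
  \<open>1\<close> for every \<open>d\<close>.
\<close>

definition reg_norm :: "real \<Rightarrow> 'a::real_inner \<Rightarrow> real"
  where "reg_norm d w = norm (w, d)"

lemma reg_norm_eq: "reg_norm d w = sqrt ((norm w)\<^sup>2 + d\<^sup>2)"
  by (simp add: reg_norm_def norm_prod_def)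

lemma reg_norm_diff_le: "\<bar>reg_norm d a - reg_norm d b\<bar> \<le> norm (a - b)"
  using norm_triangle_ineq3[of "(a, d)" "(b, d)"] by (simp add: reg_norm_def norm_prod_def)

lemma reg_norm_ge: "norm w \<le> reg_norm d w" "\<bar>d\<bar> \<le> reg_norm d w"
  unfolding reg_norm_eq by (auto intro!: real_le_rsqrt)

lemma reg_norm_le: "reg_norm d w \<le> norm w + \<bar>d\<bar>"
  unfolding reg_norm_eq using sqrt_sum_squares_le_sum_abs[of "norm w" d] by simp

lemma norm_div_reg_norm_le: "norm (w /\<^sub>R reg_norm d w) \<le> 1"
proof -
  have n: "0 \<le> reg_norm d w" by (simp add: reg_norm_def)
  then have "norm w / reg_norm d w \<le> 1"
    using reg_norm_ge(1)[of w d] by (auto simp: divide_le_eq_1)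
  then show ?thesis using n by (simp add: divide_inverse mult.commute)
qed

text \<open>
  The gradient of the regularised norm is Lipschitz with a constant that blows up as \<open>d\<close> tends to
  \<open>0\<close>. This is harmless since test fields are passed to the limit at fixed \<open>d\<close>.
\<close>

lemma div_reg_norm_diff_le:
  assumes d: "0 < d"
  shows "norm (a /\<^sub>R reg_norm d a - b /\<^sub>R reg_norm d b) \<le> 2 / d * norm (a - b)"
proof -
  have p: "d \<le> reg_norm d w" "0 < reg_norm d w" for w :: 'a
    using reg_norm_ge(2)[of d w] d by linarith+
  have c: "(reg_norm d b - reg_norm d a) / reg_norm d a * inverse (reg_norm d b) =
      inverse (reg_norm d a) - inverse (reg_norm d b)"
    using p(2)[of a] p(2)[of b] by (simp add: field_simps)
  have "a /\<^sub>R reg_norm d a - b /\<^sub>R reg_norm d b =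
      (a - b) /\<^sub>R reg_norm d a + ((reg_norm d b - reg_norm d a) / reg_norm d a) *\<^sub>R (b /\<^sub>R reg_norm d b)"
    unfolding scaleR_scaleR c by (simp add: scaleR_diff_right scaleR_diff_left)
  also have "norm \<dots> \<le> norm (a - b) / reg_norm d a + \<bar>reg_norm d b - reg_norm d a\<bar> / reg_norm d a * 1"
  proof (rule order_trans[OF norm_triangle_ineq add_mono])
    show "norm ((a - b) /\<^sub>R reg_norm d a) \<le> norm (a - b) / reg_norm d a"
      using p(2)[of a] by (simp add: divide_inverse mult.commute)
    show "norm (((reg_norm d b - reg_norm d a) / reg_norm d a) *\<^sub>R (b /\<^sub>R reg_norm d b)) \<le>
        \<bar>reg_norm d b - reg_norm d a\<bar> / reg_norm d a * 1"
      unfolding norm_scaleR[of _ "b /\<^sub>R reg_norm d b"] abs_divide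
      using p(2)[of a] by (intro mult_mono norm_div_reg_norm_le) auto
  qed
  also have "\<dots> \<le> norm (a - b) / d + norm (a - b) / d"
    unfolding mult_1_right
    using p[of a] d reg_norm_diff_le[of d b a] by (intro add_mono frac_le) (auto simp: norm_minus_commute)
  finally show ?thesis by simp
qed

lemma reg_norm_smooth_field:
  fixes \<phi> :: "real ^ 'n::finite \<Rightarrow> real ^ 'n"
  assumes \<phi>: "\<And>\<alpha>. smooth (\<lambda>x. \<phi> x $ \<alpha>)" and d: "0 < d"
  shows "(\<lambda>x. reg_norm d (\<phi> x)) differentiable (at x)"
    and "partial_deriv h (\<lambda>x. reg_norm d (\<phi> x)) x = (\<phi> x /\<^sub>R reg_norm d (\<phi> x)) \<bullet> column h (classical_jacobian \<phi> x)"
    and "continuous_on UNIV (partial_deriv h (\<lambda>x. reg_norm d (\<phi> x)))"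
proof -
  let ?s = "\<lambda>x. (\<Sum>\<alpha>\<in>UNIV. \<phi> x $ \<alpha> * \<phi> x $ \<alpha>) + d\<^sup>2"
  let ?D = "\<lambda>x \<alpha>. frechet_derivative (\<lambda>x. \<phi> x $ \<alpha>) (at x)"
  have s: "reg_norm d (\<phi> x) = sqrt (?s x)" for x
    by (simp add: reg_norm_eq power2_norm_eq_inner inner_vec_def)
  have spos: "0 < ?s x" for x
    using d by (intro add_nonneg_pos sum_nonneg) auto
  have D: "((\<lambda>x. \<phi> x $ \<alpha>) has_derivative ?D x \<alpha>) (at x)" for x \<alpha>
    by (rule smooth_has_derivative[OF \<phi>])
  have "(?s has_derivative (\<lambda>y. (\<Sum>\<alpha>\<in>UNIV. \<phi> x $ \<alpha> * ?D x \<alpha> y + ?D x \<alpha> y * \<phi> x $ \<alpha>) + 0)) (at x)" for x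
    by (intro has_derivative_add has_derivative_sum has_derivative_mult D has_derivative_const)
  from DERIV_compose_FDERIV[OF DERIV_real_sqrt[OF spos] this]
  have R: "((\<lambda>x. reg_norm d (\<phi> x)) has_derivative (\<lambda>y. ((\<Sum>\<alpha>\<in>UNIV. \<phi> x $ \<alpha> * ?D x \<alpha> y + ?D x \<alpha> y * \<phi> x $ \<alpha>) + 0) *
      (inverse (sqrt (?s x)) / 2))) (at x)" for x
    unfolding s .
  then show "(\<lambda>x. reg_norm d (\<phi> x)) differentiable (at x)"
    by (rule differentiableI)
  show eq: "partial_deriv h (\<lambda>x. reg_norm d (\<phi> x)) x = (\<phi> x /\<^sub>R reg_norm d (\<phi> x)) \<bullet> column h (classical_jacobian \<phi> x)" for x
    unfolding partial_deriv_eq[OF R]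
    by (simp add: s[symmetric] inner_vec_def column_def classical_jacobian_def partial_deriv_def
        sum_distrib_left sum_distrib_right mult_ac sum_divide_distrib)
  have c: "continuous_on UNIV (\<lambda>x. \<phi> x $ \<alpha>)" for \<alpha>
    by (rule Ck_continuous[OF \<phi>[rule_format, of 0]])
  have c': "continuous_on UNIV (partial_deriv h (\<lambda>x. \<phi> x $ \<alpha>))" for \<alpha>
    by (rule Ck_continuous[OF smooth_partial_deriv[OF \<phi>, rule_format, of 0]])
  have "partial_deriv h (\<lambda>x. reg_norm d (\<phi> x)) =
      (\<lambda>x. (\<Sum>\<alpha>\<in>UNIV. \<phi> x $ \<alpha> * partial_deriv h (\<lambda>y. \<phi> y $ \<alpha>) x) / sqrt (?s x))"
    unfolding s[symmetric]
    by (rule ext) (simp only: eq, simp add: inner_vec_def column_def classical_jacobian_def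
        divide_inverse sum_distrib_left sum_distrib_right mult_ac)
  then show "continuous_on UNIV (partial_deriv h (\<lambda>x. reg_norm d (\<phi> x)))"
    using less_imp_neq[OF spos, symmetric]
    by (simp only:) (intro continuous_intros c c' ballI, simp only: real_sqrt_eq_zero_cancel_iff not_False_eq_True)
qed


lemma reg_norm_pairing_bound:
  fixes v :: "real ^ 'n::finite" and G :: "real ^ 'n ^ 'n"
  assumes d: "0 \<le> d" "d \<le> 1" and C: "\<bar>p\<bar> \<le> C" "\<bar>q\<bar> \<le> C"
  shows "\<bar>reg_norm d v * p\<bar> \<le> C * (norm v + 1)"
    and "\<bar>((v /\<^sub>R reg_norm d v) \<bullet> column h G) * q\<bar> \<le> C * norm G"
proof -
  have C0: "0 \<le> C" using C(1) by linarith
  have "\<bar>reg_norm d v\<bar> \<le> norm v + 1"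
    using reg_norm_le[of d v] d by (simp add: reg_norm_def)
  then have "\<bar>reg_norm d v\<bar> * \<bar>p\<bar> \<le> (norm v + 1) * C"
    using C by (intro mult_mono) auto
  then show "\<bar>reg_norm d v * p\<bar> \<le> C * (norm v + 1)"
    by (simp add: abs_mult mult.commute)
  have "\<bar>(v /\<^sub>R reg_norm d v) \<bullet> column h G\<bar> \<le> norm (v /\<^sub>R reg_norm d v) * norm (column h G)"
    by (rule Cauchy_Schwarz_ineq2)
  also have "\<dots> \<le> 1 * norm G"
    by (intro mult_mono norm_div_reg_norm_le norm_column_le) auto
  finally have "\<bar>(v /\<^sub>R reg_norm d v) \<bullet> column h G\<bar> * \<bar>q\<bar> \<le> norm G * C"
    using C by (intro mult_mono) auto
  then show "\<bar>((v /\<^sub>R reg_norm d v) \<bullet> column h G) * q\<bar> \<le> C * norm G"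
    by (simp add: abs_mult mult.commute)
qed

lemma reg_norm_pairing_diff_bound:
  fixes v w :: "real ^ 'n::finite" and G J :: "real ^ 'n ^ 'n"
  assumes d: "0 < d" and C: "\<bar>p\<bar> \<le> C" "\<bar>q\<bar> \<le> C"
  shows "\<bar>(reg_norm d v * p + ((v /\<^sub>R reg_norm d v) \<bullet> column h G) * q) -
      (reg_norm d w * p + ((w /\<^sub>R reg_norm d w) \<bullet> column h J) * q)\<bar>
    \<le> (C + 2 * C / d * norm G) * (norm (v - w) + norm (G - J))"
proof -
  let ?F = "\<lambda>w. w /\<^sub>R reg_norm d w"
  have C0: "0 \<le> C" using C(1) by linarith
  have "\<bar>(?F v - ?F w) \<bullet> column h G\<bar> \<le> norm (?F v - ?F w) * norm (column h G)"
    by (rule Cauchy_Schwarz_ineq2)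
  also have "\<dots> \<le> (2 / d * norm (v - w)) * norm G"
    using d by (intro mult_mono div_reg_norm_diff_le norm_column_le) auto
  finally have 1: "\<bar>(?F v - ?F w) \<bullet> column h G\<bar> \<le> 2 / d * norm (v - w) * norm G" .
  have "\<bar>?F w \<bullet> column h (G - J)\<bar> \<le> norm (?F w) * norm (column h (G - J))"
    by (rule Cauchy_Schwarz_ineq2)
  also have "\<dots> \<le> 1 * norm (G - J)"
    by (intro mult_mono norm_div_reg_norm_le norm_column_le) auto
  finally have 2: "\<bar>?F w \<bullet> column h (G - J)\<bar> \<le> norm (G - J)" by simp
  have "(reg_norm d v * p + (?F v \<bullet> column h G) * q) - (reg_norm d w * p + (?F w \<bullet> column h J) * q)
      = (reg_norm d v - reg_norm d w) * p + ((?F v - ?F w) \<bullet> column h G + ?F w \<bullet> column h (G - J)) * q"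
    by (simp add: column_diff inner_diff_left inner_diff_right left_diff_distrib distrib_right)
  also have "\<bar>\<dots>\<bar> \<le> \<bar>reg_norm d v - reg_norm d w\<bar> * \<bar>p\<bar> +
      \<bar>(?F v - ?F w) \<bullet> column h G + ?F w \<bullet> column h (G - J)\<bar> * \<bar>q\<bar>"
    unfolding abs_mult[symmetric] by (rule abs_triangle_ineq)
  also have "\<dots> \<le> norm (v - w) * C + (2 / d * norm (v - w) * norm G + norm (G - J)) * C"
    using 1 2 C reg_norm_diff_le[of d v w] by (intro add_mono mult_mono) (auto intro: order_trans[OF abs_triangle_ineq])
  also have "\<dots> = (C + 2 * C / d * norm G) * norm (v - w) + C * norm (G - J)"
    by (simp add: algebra_simps)
  also have "\<dots> \<le> (C + 2 * C / d * norm G) * norm (v - w) + (C + 2 * C / d * norm G) * norm (G - J)"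
    using C0 d by (intro add_left_mono mult_right_mono) auto
  finally show ?thesis by (simp add: distrib_left)
qed

lemma reg_norm_tendsto: "d \<longlonglongrightarrow> 0 \<Longrightarrow> (\<lambda>n. reg_norm (d n) w) \<longlonglongrightarrow> norm w"
proof -
  assume "d \<longlonglongrightarrow> 0"
  then have "(\<lambda>n. norm (w, d n)) \<longlonglongrightarrow> norm (w, 0::real)"
    by (intro tendsto_norm tendsto_Pair tendsto_const)
  then show ?thesis by (simp add: reg_norm_def norm_prod_def)
qed

lemma div_reg_norm_tendsto:
  assumes "d \<longlonglongrightarrow> 0"
  shows "(\<lambda>n. w /\<^sub>R reg_norm (d n) w) \<longlonglongrightarrow> w /\<^sub>R norm w"
proof (cases "w = 0")
  case False
  then show ?thesis
    by (intro tendsto_scaleR tendsto_inverse reg_norm_tendsto assms tendsto_const) simp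
qed simp

lemma measurable_reg_norm:
  fixes v :: "'a \<Rightarrow> 'b::euclidean_space"
  assumes "v \<in> borel_measurable M"
  shows "(\<lambda>x. reg_norm d (v x)) \<in> borel_measurable M"
  unfolding reg_norm_eq using assms by measurable

text \<open>
  For a test field the chain rule for the regularised norm is classical. The density argument carries it to
  \<open>v\<close> at fixed \<open>d > 0\<close>, and dominated convergence lets \<open>d\<close> tend to
  \<open>0\<close>.
\<close>

lemma W12_0_norm_pairing:
  fixes v :: "real ^ 'n::finite \<Rightarrow> real ^ 'n"
  assumes \<Omega>: "open \<Omega>" and v: "v \<in> W12_0 \<Omega>" and \<psi>: "test_function \<Omega> \<psi>"
  defines "G \<equiv> weak_jacobian \<Omega> v"
  shows "(LINT x|lebesgue_on \<Omega>. norm (v x) * partial_deriv h \<psi> x) =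
    - (LINT x|lebesgue_on \<Omega>. ((v x /\<^sub>R norm (v x)) \<bullet> column h (G x)) * \<psi> x)"
proof -
  let ?M = "lebesgue_on \<Omega>"
  let ?P = "partial_deriv h \<psi>"
  have W: "v \<in> W12 \<Omega>" using v by (simp add: W12_0_def)
  note GW = W12_weak_jacobian[OF \<Omega> W, folded G_def]
  have vm: "v \<in> borel_measurable ?M" and Gm: "G \<in> borel_measurable ?M"
    using GW(1,2) by (simp_all add: square_integrable_def)
  obtain K where K: "compact K" "K \<subseteq> \<Omega>" "\<And>x. x \<notin> K \<Longrightarrow> \<psi> x = 0" "\<And>x. x \<notin> K \<Longrightarrow> ?P x = 0"
    using test_function_support[OF \<psi>] by metis
  have c\<psi>: "continuous_on UNIV \<psi>" and cP: "continuous_on UNIV ?P"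
    using Ck_continuous[OF test_function_smooth[OF \<psi>, rule_format, of 0]]
      Ck_continuous[OF smooth_partial_deriv[OF test_function_smooth[OF \<psi>], rule_format, of 0]] .
  obtain C1 where C1: "\<And>x. \<bar>\<psi> x\<bar> \<le> C1"
    using continuous_bounded_if_compact_support[OF c\<psi> K(1,3)] by metis
  obtain C2 where C2: "\<And>x. \<bar>?P x\<bar> \<le> C2"
    using continuous_bounded_if_compact_support[OF cP K(1,4)] by metis
  define C where "C = max C1 C2"
  have C: "\<bar>\<psi> x\<bar> \<le> C" "\<bar>?P x\<bar> \<le> C" for x
    using C1[of x] C2[of x] by (auto simp: C_def)
  have \<psi>m: "\<psi> \<in> borel_measurable ?M" and Pm: "?P \<in> borel_measurable ?M"
    by (intro measurable_restrict_space1 borel_measurable_lebesgue_continuous c\<psi> cP)+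
  have C0: "0 \<le> C" using C(1)[of 0] by linarith
  let ?k = "indicat_real K"
  have k: "square_integrable \<Omega> ?k"
    by (rule square_integrable_indicator_compact[OF \<Omega> K(1)])
  \<comment> \<open>A dominating function for all \<open>d\<close> in the unit interval; the indicator of \<open>K\<close> is there because constants need not be integrable on \<open>\<Omega>\<close>.\<close>
  define B where "B x = C * (norm (?k x) * norm (v x) + norm (?k x) * norm (?k x)) + C * (norm (?k x) * norm (G x))" for x
  have iB: "integrable ?M B"
    unfolding B_def
    by (intro Bochner_Integration.integrable_add integrable_mult_right square_integrable_norm_mult k GW)
  define I1 where "I1 d x = reg_norm d (v x) * ?P x" for d x
  define I2 where "I2 d x = ((v x /\<^sub>R reg_norm d (v x)) \<bullet> column h (G x)) * \<psi> x" for d x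
  have m1: "I1 d \<in> borel_measurable ?M" for d
    unfolding I1_def by (intro borel_measurable_times measurable_reg_norm vm Pm)
  have m2: "I2 d \<in> borel_measurable ?M" for d
    unfolding I2_def
    by (intro borel_measurable_times borel_measurable_inner borel_measurable_scaleR
        borel_measurable_inverse measurable_reg_norm vm measurable_column Gm \<psi>m)
  have b12: "\<bar>I1 d x\<bar> + \<bar>I2 d x\<bar> \<le> B x" if d: "0 \<le> d" "d \<le> 1" for d x
  proof (cases "x \<in> K")
    case True
    then show ?thesis
      using reg_norm_pairing_bound(1)[OF d C(2)[of x] C(1)[of x], of "v x"]
        reg_norm_pairing_bound(2)[OF d C(2)[of x] C(1)[of x], of "v x" h "G x"]
      unfolding I1_def I2_def B_def by simp
  next
    case False
    then show ?thesis
      using K by (simp add: I1_def I2_def B_def)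
  qed
  have i1: "integrable ?M (I1 d)" and i2: "integrable ?M (I2 d)" if d: "0 \<le> d" "d \<le> 1" for d
    using b12[OF d] by (intro integrable_if_abs_le[OF iB] m1 m2; smt (verit))+
  have zero: "(LINT x|?M. I1 d x + I2 d x) = 0" if d: "0 < d" "d \<le> 1" for d
  proof (rule integral_eq_0_by_density[OF \<Omega> v])
    have d0: "0 \<le> d" using d by simp
    show "integrable ?M (\<lambda>x. I1 d x + I2 d x)"
      by (intro Bochner_Integration.integrable_add i1 i2 d0 d)
    show "square_integrable \<Omega> (\<lambda>x. C *\<^sub>R ?k x + 2 * C / d * norm (G x))"
    proof (rule square_integrable_add)
      show "square_integrable \<Omega> (\<lambda>x. C *\<^sub>R ?k x)"
        using k C0 by (intro square_integrable_bound[OF k, where C = C]) (auto simp: square_integrable_def)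
      show "square_integrable \<Omega> (\<lambda>x. 2 * C / d * norm (G x))"
        using GW(2) C0 d by (intro square_integrable_bound[OF GW(2), where C = "2 * C / d"])
          (auto simp: square_integrable_def)
    qed
    fix \<phi> :: "real ^ 'n \<Rightarrow> real ^ 'n" assume \<phi>: "test_field \<Omega> \<phi>"
    let ?J1 = "\<lambda>x. reg_norm d (\<phi> x) * ?P x"
    let ?J2 = "\<lambda>x. ((\<phi> x /\<^sub>R reg_norm d (\<phi> x)) \<bullet> column h (classical_jacobian \<phi> x)) * \<psi> x"
    have sm: "smooth (\<lambda>x. \<phi> x $ \<alpha>)" for \<alpha>
      using \<phi> test_function_smooth unfolding test_field_def by blast
    note r = reg_norm_smooth_field[of \<phi>, OF sm d(1)]
    have w: "is_weak_grad \<Omega> (\<lambda>x. reg_norm d (\<phi> x)) (\<lambda>x. \<chi> h. partial_deriv h (\<lambda>x. reg_norm d (\<phi> x)) x)"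
      by (rule is_weak_grad_classical[OF \<Omega> r(1) r(3)])
    have j1: "integrable ?M ?J1"
      using w by (intro integrable_locally_integrable_test_function[OF \<Omega> _ test_function_partial_deriv[OF \<psi>]])
        (simp add: is_weak_grad_def)
    have "integrable ?M (\<lambda>x. partial_deriv h (\<lambda>x. reg_norm d (\<phi> x)) x * \<psi> x)"
      using w by (intro integrable_locally_integrable_test_function[OF \<Omega> _ \<psi>]) (simp add: is_weak_grad_def)
    then have j2: "integrable ?M ?J2" by (simp only: r(2))
    show "integrable ?M (\<lambda>x. ?J1 x + ?J2 x)"
      by (rule Bochner_Integration.integrable_add[OF j1 j2])
    have "(LINT x|?M. ?J1 x) = - (LINT x|?M. ?J2 x)"
      using integration_by_parts[OF \<Omega> \<psi> r(1) r(3), of h] by (simp only: r(2))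
    then show "(LINT x|?M. ?J1 x + ?J2 x) = 0"
      by (simp only: Bochner_Integration.integral_add[OF j1 j2])
    fix x
    show "\<bar>(I1 d x + I2 d x) - (?J1 x + ?J2 x)\<bar> \<le> (C *\<^sub>R ?k x + 2 * C / d * norm (G x)) *
        (norm (v x - \<phi> x) + norm (weak_jacobian \<Omega> v x - classical_jacobian \<phi> x))"
    proof (cases "x \<in> K")
      case True
      then show ?thesis
        using reg_norm_pairing_diff_bound[OF d(1) C(2)[of x] C(1)[of x], of "v x" h "G x" "\<phi> x" "classical_jacobian \<phi> x"]
        by (simp add: I1_def I2_def G_def)
    next
      case False
      then show ?thesis
        using K C0 d by (simp add: I1_def I2_def)
    qed
  qed
  define d where "d n = 1 / real (Suc n)" for n
  have d: "0 < d n" "0 \<le> d n" "d n \<le> 1" for n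
    by (simp_all add: d_def)
  have d0: "d \<longlonglongrightarrow> 0"
    unfolding d_def using LIMSEQ_Suc lim_1_over_n by blast
  \<comment> \<open>\<open>I1 0\<close> and \<open>I2 0\<close> are the integrands for the norm itself.\<close>
  have "(\<lambda>n. LINT x|?M. I1 (d n) x + I2 (d n) x) \<longlonglongrightarrow> (LINT x|?M. I1 0 x + I2 0 x)"
  proof (rule integral_dominated_convergence[OF _ _ iB])
    show "(\<lambda>x. I1 0 x + I2 0 x) \<in> borel_measurable ?M"
      by (intro borel_measurable_add m1 m2)
    show "(\<lambda>x. I1 (d n) x + I2 (d n) x) \<in> borel_measurable ?M" for n
      by (intro borel_measurable_add m1 m2)
    have "(\<lambda>n. I1 (d n) x + I2 (d n) x) \<longlonglongrightarrow> norm (v x) * ?P x + ((v x /\<^sub>R norm (v x)) \<bullet> column h (G x)) * \<psi> x" for x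
      unfolding I1_def I2_def
      by (intro tendsto_add tendsto_mult tendsto_inner reg_norm_tendsto div_reg_norm_tendsto d0 tendsto_const)
    moreover have "I1 0 x + I2 0 x = norm (v x) * ?P x + ((v x /\<^sub>R norm (v x)) \<bullet> column h (G x)) * \<psi> x" for x
      by (simp add: I1_def I2_def reg_norm_def norm_prod_def)
    ultimately show "AE x in ?M. (\<lambda>n. I1 (d n) x + I2 (d n) x) \<longlonglongrightarrow> I1 0 x + I2 0 x"
      by simp
    show "AE x in ?M. norm (I1 (d n) x + I2 (d n) x) \<le> B x" for n
      using b12[OF d(2,3), of n] by (intro AE_I2) (metis abs_triangle_ineq order_trans real_norm_def)
  qed
  then have "(LINT x|?M. I1 0 x + I2 0 x) = 0"
    unfolding zero[OF d(1,3)] by (simp add: LIMSEQ_const_iff)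
  then have "(LINT x|?M. I1 0 x) + (LINT x|?M. I2 0 x) = 0"
    using Bochner_Integration.integral_add[OF i1[of 0] i2[of 0]] by simp
  then show ?thesis
    by (simp add: I1_def I2_def reg_norm_def norm_prod_def eq_neg_iff_add_eq_0)
qed

text \<open>
  Where \<open>v x = 0\<close> the inverse of the norm is \<open>0\<close>, so the stated gradient vanishes there.
\<close>

lemma W12_0_norm_weak_grad:
  fixes v :: "real ^ 'n::finite \<Rightarrow> real ^ 'n"
  assumes \<Omega>: "open \<Omega>" and v: "v \<in> W12_0 \<Omega>"
  shows "is_weak_grad \<Omega> (\<lambda>x. norm (v x)) (\<lambda>x. \<chi> h. (v x /\<^sub>R norm (v x)) \<bullet> column h (weak_jacobian \<Omega> v x))"
  unfolding is_weak_grad_def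
proof (intro conjI allI impI)
  let ?G = "weak_jacobian \<Omega> v"
  have W: "v \<in> W12 \<Omega>" using v by (simp add: W12_0_def)
  note GW = W12_weak_jacobian[OF \<Omega> W]
  have vm: "v \<in> borel_measurable (lebesgue_on \<Omega>)" and Gm: "?G \<in> borel_measurable (lebesgue_on \<Omega>)"
    using GW(1,2) by (simp_all add: square_integrable_def)
  show "locally_integrable \<Omega> (\<lambda>x. norm (v x))"
  proof (rule square_integrable_imp_locally_integrable[OF \<Omega>], rule square_integrable_bound[OF GW(1), where C = 1])
    show "(\<lambda>x. norm (v x)) \<in> borel_measurable (lebesgue_on \<Omega>)"
      by (rule measurable_compose[OF vm borel_measurable_norm])
  qed simp
  show "locally_integrable \<Omega> (\<lambda>x. (\<chi> h. (v x /\<^sub>R norm (v x)) \<bullet> column h (?G x)) $ h)" for h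
  proof (intro square_integrable_imp_locally_integrable[OF \<Omega>] square_integrable_bound[OF GW(2), where C = 1])
    show "(\<lambda>x. (\<chi> h. (v x /\<^sub>R norm (v x)) \<bullet> column h (?G x)) $ h) \<in> borel_measurable (lebesgue_on \<Omega>)"
      unfolding vec_lambda_beta
      by (intro borel_measurable_inner borel_measurable_scaleR borel_measurable_inverse
          measurable_compose[OF vm borel_measurable_norm] vm measurable_column Gm)
    show "norm ((\<chi> h. (v x /\<^sub>R norm (v x)) \<bullet> column h (?G x)) $ h) \<le> 1 * norm (?G x)" for x
      using reg_norm_pairing_bound(2)[of 0 0 1 1 "v x" h "?G x"]
      by (simp add: reg_norm_def norm_prod_def)
  qed
  fix \<psi> h assume "test_function \<Omega> \<psi>"
  from W12_0_norm_pairing[OF \<Omega> v this, of h]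
  show "(LINT x|lebesgue_on \<Omega>. norm (v x) * partial_deriv h \<psi> x) =
      - (LINT x|lebesgue_on \<Omega>. (\<chi> h. (v x /\<^sub>R norm (v x)) \<bullet> column h (?G x)) $ h * \<psi> x)"
    by simp
qed



section \<open>The integrand as a quadratic form\<close>

lemma coeff_form_lame:
  "coeff_form (lame_coeff lam mu) X Y =
    mu * (X \<bullet> Y) + lam * (trace X * trace Y) + mu * trace (X ** Y)"
  for X Y :: "real ^ 'n::finite ^ 'n"
proof -
  have K: "(\<Sum>j\<in>UNIV. kron i j * f j) = f i" "(\<Sum>j\<in>UNIV. kron j i * f j) = f i"
    for i :: 'n and f :: "'n \<Rightarrow> real"
    by (simp_all add: kron_def if_distrib[of "\<lambda>c. c * _"] cong: if_cong)
  have "coeff_form (lame_coeff lam mu) X Y = (\<Sum>h\<in>UNIV. \<Sum>\<alpha>\<in>UNIV. \<Sum>k\<in>UNIV. \<Sum>\<beta>\<in>UNIV.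
      lame_coeff lam mu h k \<alpha> \<beta> * X $ \<beta> $ k * Y $ \<alpha> $ h)"
    unfolding coeff_form_def by (intro sum.cong refl sum.swap)
  also have "\<dots> = (\<Sum>h\<in>UNIV. \<Sum>\<alpha>\<in>UNIV. (\<Sum>k\<in>UNIV. \<Sum>\<beta>\<in>UNIV. lame_coeff lam mu h k \<alpha> \<beta> * X $ \<beta> $ k) * Y $ \<alpha> $ h)"
    by (simp add: sum_distrib_right)
  also have "\<dots> = (\<Sum>h\<in>UNIV. \<Sum>\<alpha>\<in>UNIV. mu * (X $ \<alpha> $ h * Y $ \<alpha> $ h)
      + lam * trace X * (kron \<alpha> h * Y $ \<alpha> $ h) + mu * (X $ h $ \<alpha> * Y $ \<alpha> $ h))"
    unfolding lame_coeff_stress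
    by (intro sum.cong refl) (auto simp: mat_def kron_def transpose_def algebra_simps)
  also have "\<dots> = mu * (\<Sum>h\<in>UNIV. \<Sum>\<alpha>\<in>UNIV. X $ \<alpha> $ h * Y $ \<alpha> $ h)
      + lam * trace X * (\<Sum>h\<in>UNIV. \<Sum>\<alpha>\<in>UNIV. kron \<alpha> h * Y $ \<alpha> $ h)
      + mu * (\<Sum>h\<in>UNIV. \<Sum>\<alpha>\<in>UNIV. X $ h $ \<alpha> * Y $ \<alpha> $ h)"
    by (simp add: sum.distrib sum_distrib_left)
  also have "(\<Sum>h\<in>UNIV. \<Sum>\<alpha>\<in>UNIV. kron \<alpha> h * Y $ \<alpha> $ h) = trace Y"
    by (simp add: K trace_def)
  also have "(\<Sum>h\<in>UNIV. \<Sum>\<alpha>\<in>UNIV. X $ \<alpha> $ h * Y $ \<alpha> $ h) = X \<bullet> Y"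
    unfolding inner_vec_def by (subst sum.swap) simp
  also have "(\<Sum>h\<in>UNIV. \<Sum>\<alpha>\<in>UNIV. X $ h $ \<alpha> * Y $ \<alpha> $ h) = trace (X ** Y)"
    by (simp add: trace_def matrix_matrix_mult_def)
  finally show ?thesis by (simp add: mult.assoc)
qed

lemma minors_form_self: "minors_form X X = trace (X ** X) - (trace X)\<^sup>2"
  by (simp add: minors_form_def trace_def matrix_matrix_mult_def sum_subtractf power2_eq_square
      sum_product)

lemma inner_matrix_trace: "X \<bullet> Y = trace (transpose X ** Y)" for X Y :: "real ^ 'n::finite ^ 'n"
proof -
  have "X \<bullet> Y = (\<Sum>h\<in>UNIV. \<Sum>\<alpha>\<in>UNIV. X $ \<alpha> $ h * Y $ \<alpha> $ h)"
    unfolding inner_vec_def by (subst sum.swap) simp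
  then show ?thesis by (simp add: trace_def matrix_matrix_mult_def transpose_def)
qed

definition outer_product :: "real ^ 'n \<Rightarrow> real ^ 'n \<Rightarrow> real ^ 'n ^ 'n"
  where "outer_product a b = (\<chi> i j. a $ i * b $ j)"

lemma outer_product_inner: "outer_product a b \<bullet> X = a \<bullet> (X *v b)" "X \<bullet> outer_product a b = a \<bullet> (X *v b)"
  for X :: "real ^ 'n::finite ^ 'n"
  by (simp_all add: outer_product_def inner_vec_def matrix_vector_mult_def sum_distrib_left mult_ac)

lemma trace_outer_product: "trace (outer_product a b) = a \<bullet> b"
  by (simp add: trace_def outer_product_def inner_vec_def)

lemma trace_outer_product_mult: "trace (outer_product a b ** X) = b \<bullet> (X *v a)" for X :: "real ^ 'n::finite ^ 'n"
proof -
  have "trace (outer_product a b ** X) = (\<Sum>i\<in>UNIV. \<Sum>k\<in>UNIV. b $ k * (X $ k $ i * a $ i))"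
    by (simp add: trace_def outer_product_def matrix_matrix_mult_def mult_ac)
  also have "\<dots> = b \<bullet> (X *v a)"
    by (subst sum.swap) (simp add: inner_vec_def matrix_vector_mult_def sum_distrib_left)
  finally show ?thesis .
qed

lemma outer_product_vector: "outer_product a b *v c = (b \<bullet> c) *\<^sub>R a"
  by (simp add: vec_eq_iff outer_product_def matrix_vector_mult_def inner_vec_def sum_distrib_left sum_distrib_right mult_ac)

text \<open>
  The form is symmetric, so the terms linear in \<open>g\<close> cancel.
\<close>

lemma coeff_form_lame_radial:
  fixes X :: "real ^ 'n::finite ^ 'n" and w :: "real ^ 'n"
  defines "b \<equiv> transpose X *v w"
  shows "coeff_form (lame_coeff lam mu) (X - g *\<^sub>R outer_product w b) (X + g *\<^sub>R outer_product w b) =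
    mu * (X \<bullet> X) + lam * (trace X)\<^sup>2 + mu * trace (X ** X)
      - g\<^sup>2 * (mu * ((w \<bullet> w) * (b \<bullet> b)) + (lam + mu) * (w \<bullet> (X *v w))\<^sup>2)"
proof -
  have wb: "w \<bullet> b = w \<bullet> (X *v w)"
    unfolding b_def by (metis dot_lmul_matrix inner_commute vector_transpose_matrix)
  have V: "trace (outer_product w b) = w \<bullet> (X *v w)" "trace (outer_product w b ** X) = trace (X ** outer_product w b)"
    "trace (outer_product w b ** outer_product w b) = (w \<bullet> (X *v w))\<^sup>2"
    "outer_product w b \<bullet> outer_product w b = (w \<bullet> w) * (b \<bullet> b)"
    by (simp_all add: trace_outer_product wb trace_mul_sym[of X] trace_outer_product_mult outer_product_vector outer_product_inner power2_eq_square inner_commute[of b w])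
  have d: "trace (A ** (B + C)) = trace (A ** B) + trace (A ** C)" "trace ((A - B) ** C) = trace (A ** C) - trace (B ** C)"
    "trace (A ** (r *\<^sub>R B)) = r * trace (A ** B)" "trace ((r *\<^sub>R A) ** B) = r * trace (A ** B)"
    "trace (r *\<^sub>R A) = r * trace A"
    for A B C :: "real ^ 'n ^ 'n" and r
    by (simp_all add: trace_def matrix_matrix_mult_def distrib_left left_diff_distrib right_diff_distrib sum.distrib sum_subtractf sum_distrib_left mult_ac)
  show ?thesis
    unfolding coeff_form_lame d trace_add trace_sub V
    by (simp add: inner_diff_left inner_add_right d V inner_commute[of "outer_product w b" X] power2_eq_square algebra_simps)
qed

section \<open>Pointwise nonnegativity\<close>

lemma quadratic_form_nonneg:
  fixes a b c x y :: real
  assumes "0 < a" "b\<^sup>2 \<le> a * c"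
  shows "0 \<le> a * x\<^sup>2 + 2 * b * (x * y) + c * y\<^sup>2"
proof -
  have "0 \<le> (a * x + b * y)\<^sup>2 + (a * c - b\<^sup>2) * y\<^sup>2"
    using assms by simp
  also have "\<dots> = a * (a * x\<^sup>2 + 2 * b * (x * y) + c * y\<^sup>2)"
    by (simp add: power2_eq_square algebra_simps)
  finally show ?thesis
    using assms(1) by (simp add: zero_le_mult_iff)
qed

text \<open>
  Symmetrised over \<open>(i, j)\<close> and \<open>(j, i)\<close>, every summand on the right is nonnegative because
  \<open>\<bar>s\<bar> \<le> mu\<close>, so only the diagonal ones need to be kept.
\<close>

lemma double_sum_diag_bound:
  fixes z :: "'a \<Rightarrow> 'a \<Rightarrow> real"
  assumes S: "finite S" and s: "\<bar>s\<bar> \<le> mu"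
  shows "(mu + s) * (\<Sum>i\<in>S. (z i i)\<^sup>2) \<le> mu * (\<Sum>i\<in>S. \<Sum>j\<in>S. (z i j)\<^sup>2) + s * (\<Sum>i\<in>S. \<Sum>j\<in>S. z i j * z j i)"
proof -
  define f where "f i j = mu * (z i j)\<^sup>2 + mu * (z j i)\<^sup>2 + 2 * s * (z i j * z j i)" for i j
  have f0: "0 \<le> f i j" for i j
  proof -
    have "\<bar>s * (z i j * z j i)\<bar> \<le> mu * (((z i j)\<^sup>2 + (z j i)\<^sup>2) / 2)"
      unfolding abs_mult[of s] using s sum_squares_bound[of "\<bar>z i j\<bar>" "\<bar>z j i\<bar>"]
      by (intro mult_mono) (auto simp: abs_mult)
    then show ?thesis by (simp add: f_def distrib_left)
  qed
  have "2 * ((mu + s) * (\<Sum>i\<in>S. (z i i)\<^sup>2)) = (\<Sum>i\<in>S. f i i)"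
    by (simp add: f_def sum_distrib_left power2_eq_square algebra_simps)
  also have "\<dots> \<le> (\<Sum>i\<in>S. \<Sum>j\<in>S. f i j)"
    by (intro sum_mono member_le_sum f0 S)
  also have "\<dots> = mu * (\<Sum>i\<in>S. \<Sum>j\<in>S. (z i j)\<^sup>2) + mu * (\<Sum>i\<in>S. \<Sum>j\<in>S. (z j i)\<^sup>2)
      + 2 * (s * (\<Sum>i\<in>S. \<Sum>j\<in>S. z i j * z j i))"
    by (simp add: f_def sum.distrib sum_distrib_left mult.assoc)
  also have "(\<Sum>i\<in>S. \<Sum>j\<in>S. (z j i)\<^sup>2) = (\<Sum>i\<in>S. \<Sum>j\<in>S. (z i j)\<^sup>2)"
    by (rule sum.swap)
  finally show ?thesis by linarith
qed

lemma double_sum_remove: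
  fixes f :: "'a::finite \<Rightarrow> 'a \<Rightarrow> real"
  shows "(\<Sum>i\<in>UNIV. \<Sum>j\<in>UNIV. f i j) =
    f k k + (\<Sum>j\<in>UNIV - {k}. f k j + f j k) + (\<Sum>i\<in>UNIV - {k}. \<Sum>j\<in>UNIV - {k}. f i j)"
proof -
  have r: "(\<Sum>j\<in>UNIV. g j) = g k + (\<Sum>j\<in>UNIV - {k}. g j)" for g :: "'a \<Rightarrow> real"
    by (rule sum.remove) auto
  show ?thesis
    unfolding r by (simp add: sum.distrib)
qed

text \<open>
  For \<open>w\<close> the \<open>k\<close>-th basis vector the form of \<open>pointwise_form_nonneg\<close> splits
  into three parts: the pairs \<open>z k j\<close>, \<open>z j k\<close> with \<open>j \<noteq> k\<close>, controlled
  by the bound on \<open>s\<^sup>2\<close>; the block without row and column \<open>k\<close>, bounded below through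
  the square of its trace \<open>\<tau>\<close>; and the pair \<open>z k k\<close>, \<open>\<tau>\<close>, controlled
  by the bound on \<open>(L - s)\<^sup>2\<close>.
\<close>

lemma pointwise_form_nonneg_coordinates:
  fixes z :: "'n::finite \<Rightarrow> 'n \<Rightarrow> real"
  assumes n: "CARD('n) \<ge> 2" and mu: "0 < mu" and N: "0 < L + mu" and k2: "0 < k2"
    and s: "\<bar>s\<bar> \<le> mu" "s\<^sup>2 \<le> mu\<^sup>2 * k2"
    and D: "(L - s)\<^sup>2 \<le> (L + mu) * k2 * ((mu + s) / (real CARD('n) - 1) + (L - s))"
  shows "0 \<le> mu * (\<Sum>i\<in>UNIV. \<Sum>j\<in>UNIV. (z i j)\<^sup>2) + (L - s) * (\<Sum>i\<in>UNIV. z i i)\<^sup>2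
    + s * (\<Sum>i\<in>UNIV. \<Sum>j\<in>UNIV. z i j * z j i)
    - (1 - k2) * (mu * (\<Sum>j\<in>UNIV. (z k j)\<^sup>2) + L * (z k k)\<^sup>2)"
proof -
  define S where "S = UNIV - {k}"
  define m where "m = real CARD('n) - 1"
  have m: "0 < m" using n by (simp add: m_def)
  have cS: "real (card S) = m"
    using n by (simp add: S_def m_def card_Diff_singleton of_nat_diff)
  define \<tau> where "\<tau> = (\<Sum>i\<in>S. z i i)"
  define Y where "Y = mu * (\<Sum>i\<in>S. \<Sum>j\<in>S. (z i j)\<^sup>2) + s * (\<Sum>i\<in>S. \<Sum>j\<in>S. z i j * z j i)"
  define P where "P = (\<Sum>j\<in>S. (z k j)\<^sup>2)"
  define Q where "Q = (\<Sum>j\<in>S. (z j k)\<^sup>2)"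
  define R where "R = (\<Sum>j\<in>S. z k j * z j k)"
  have r: "(\<Sum>j\<in>UNIV. g j) = g k + (\<Sum>j\<in>S. g j)" for g :: "'n \<Rightarrow> real"
    unfolding S_def by (rule sum.remove) auto
  have Y: "(mu + s) / m * \<tau>\<^sup>2 \<le> Y"
  proof -
    have "\<tau>\<^sup>2 \<le> (\<Sum>i\<in>S. (z i i)\<^sup>2) * m"
      unfolding \<tau>_def cS[symmetric] by (rule sum_squared_le_sum_of_squares)
    then have "(mu + s) * \<tau>\<^sup>2 \<le> (mu + s) * ((\<Sum>i\<in>S. (z i i)\<^sup>2) * m)"
      using s by (intro mult_left_mono) auto
    then have "(mu + s) / m * \<tau>\<^sup>2 \<le> (mu + s) * (\<Sum>i\<in>S. (z i i)\<^sup>2)"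
      using m by (simp add: divide_le_eq mult.assoc)
    also have "\<dots> \<le> Y"
      unfolding Y_def by (rule double_sum_diag_bound) (use s in auto)
    finally show ?thesis .
  qed
  have q1: "0 \<le> (L + mu) * k2 * (z k k)\<^sup>2 + 2 * (L - s) * (z k k * \<tau>) + ((mu + s) / m + (L - s)) * \<tau>\<^sup>2"
    using D N k2 by (intro quadratic_form_nonneg) (simp_all add: m_def)
  have q2: "0 \<le> mu * k2 * P + 2 * s * R + mu * Q"
  proof -
    have "0 \<le> mu * k2 * x\<^sup>2 + 2 * s * (x * y) + mu * y\<^sup>2" for x y
      using s(2) mu k2 by (intro quadratic_form_nonneg) (simp_all add: power2_eq_square mult_ac)
    then have "0 \<le> (\<Sum>j\<in>S. mu * k2 * (z k j)\<^sup>2 + 2 * s * (z k j * z j k) + mu * (z j k)\<^sup>2)"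
      by (intro sum_nonneg)
    then show ?thesis
      by (simp add: P_def Q_def R_def sum.distrib sum_distrib_left)
  qed
  have A: "(\<Sum>i\<in>UNIV. \<Sum>j\<in>UNIV. (z i j)\<^sup>2) = (z k k)\<^sup>2 + (P + Q) + (\<Sum>i\<in>S. \<Sum>j\<in>S. (z i j)\<^sup>2)"
    unfolding double_sum_remove[of _ k] by (simp add: P_def Q_def S_def sum.distrib)
  have B: "(\<Sum>i\<in>UNIV. \<Sum>j\<in>UNIV. z i j * z j i) = (z k k)\<^sup>2 + 2 * R + (\<Sum>i\<in>S. \<Sum>j\<in>S. z i j * z j i)"
    unfolding double_sum_remove[of _ k]
    by (simp add: R_def S_def power2_eq_square mult.commute sum_distrib_left flip: mult_2)
  have T: "(\<Sum>i\<in>UNIV. z i i) = z k k + \<tau>"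
    unfolding \<tau>_def by (rule r)
  have P: "(\<Sum>j\<in>UNIV. (z k j)\<^sup>2) = (z k k)\<^sup>2 + P"
    unfolding P_def by (rule r)
  have "mu * (\<Sum>i\<in>UNIV. \<Sum>j\<in>UNIV. (z i j)\<^sup>2) + (L - s) * (\<Sum>i\<in>UNIV. z i i)\<^sup>2
    + s * (\<Sum>i\<in>UNIV. \<Sum>j\<in>UNIV. z i j * z j i)
    - (1 - k2) * (mu * (\<Sum>j\<in>UNIV. (z k j)\<^sup>2) + L * (z k k)\<^sup>2) =
    ((L + mu) * k2 * (z k k)\<^sup>2 + 2 * (L - s) * (z k k * \<tau>) + ((mu + s) / m + (L - s)) * \<tau>\<^sup>2)
    + (mu * k2 * P + 2 * s * R + mu * Q) + (Y - (mu + s) / m * \<tau>\<^sup>2)"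
    unfolding A B T P Y_def by (simp add: power2_eq_square algebra_simps)
  then show ?thesis
    using q1 q2 Y by linarith
qed

text \<open>
  Traces, the Frobenius product and the quantities in \<open>w\<close> are invariant under conjugation with an
  orthogonal matrix that takes a basis vector to \<open>w\<close>.
\<close>

lemma pointwise_form_nonneg:
  fixes X :: "real ^ 'n::finite ^ 'n" and w :: "real ^ 'n"
  assumes n: "CARD('n) \<ge> 2" and mu: "0 < mu" and N: "0 < L + mu" and k2: "0 < k2"
    and s: "\<bar>s\<bar> \<le> mu" "s\<^sup>2 \<le> mu\<^sup>2 * k2"
    and D: "(L - s)\<^sup>2 \<le> (L + mu) * k2 * ((mu + s) / (real CARD('n) - 1) + (L - s))"
    and w: "norm w = 1"
  defines "b \<equiv> transpose X *v w"
  shows "0 \<le> mu * (X \<bullet> X) + (L - s) * (trace X)\<^sup>2 + s * trace (X ** X)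
    - (1 - k2) * (mu * (b \<bullet> b) + L * (w \<bullet> (X *v w))\<^sup>2)"
proof -
  obtain k :: 'n where True by simp
  have "norm (axis k (1::real)) = norm w" using w by simp
  then obtain f where f: "orthogonal_transformation f" "f (axis k (1::real)) = w"
    using orthogonal_transformation_exists[of "axis k (1::real)" w] by blast
  define Q where "Q = matrix f"
  have Q: "orthogonal_matrix Q"
    using f(1) by (simp add: Q_def orthogonal_transformation_matrix)
  have QQ: "Q ** transpose Q = mat 1" "transpose Q ** Q = mat 1"
    using Q by (simp_all add: orthogonal_matrix_def)
  have Qw: "Q *v axis k 1 = w"
    using f by (simp add: Q_def orthogonal_transformation_linear matrix_works)
  define Z where "Z = transpose Q ** X ** Q"
  have trans: "transpose Z = transpose Q ** transpose X ** Q"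
    by (simp add: Z_def matrix_transpose_mul matrix_mul_assoc)
  have conj: "trace ((transpose Q ** A ** Q) ** (transpose Q ** B ** Q)) = trace (A ** B)" for A B
  proof -
    have "(transpose Q ** A ** Q) ** (transpose Q ** B ** Q) = transpose Q ** (A ** (Q ** transpose Q) ** B ** Q)"
      by (simp only: matrix_mul_assoc)
    also have "trace \<dots> = trace ((A ** (Q ** transpose Q) ** B ** Q) ** transpose Q)"
      by (rule trace_mul_sym)
    also have "\<dots> = trace (A ** (Q ** transpose Q) ** B ** (Q ** transpose Q))"
      by (simp only: matrix_mul_assoc)
    finally show ?thesis by (simp add: QQ(1))
  qed
  have t1: "trace X = trace Z"
  proof -
    have "trace Z = trace (X ** (Q ** transpose Q))"
      unfolding Z_def matrix_mul_assoc[symmetric] by (subst trace_mul_sym) (simp only: matrix_mul_assoc)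
    then show ?thesis by (simp add: QQ(1))
  qed
  have t2: "trace (X ** X) = trace (Z ** Z)" "X \<bullet> X = Z \<bullet> Z"
    unfolding inner_matrix_trace trans unfolding Z_def conj by simp_all
  have Zk: "Z *v axis k 1 = transpose Q *v (X *v w)" "transpose Z *v axis k 1 = transpose Q *v b"
    unfolding trans b_def unfolding Z_def matrix_vector_mul_assoc[symmetric] Qw by (rule refl)+
  have iso: "(transpose Q *v x) \<bullet> (transpose Q *v y) = x \<bullet> y" for x y
    by (metis QQ(1) dot_lmul_matrix matrix_vector_mul_assoc matrix_vector_mul_lid transpose_matrix_vector)
  have bb: "b \<bullet> b = (\<Sum>j\<in>UNIV. (Z $ k $ j)\<^sup>2)"
  proof -
    have "b \<bullet> b = (transpose Z *v axis k 1) \<bullet> (transpose Z *v axis k 1)"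
      unfolding Zk(2) iso ..
    then show ?thesis
      by (simp add: inner_vec_def matrix_vector_mult_basis column_def transpose_def power2_eq_square)
  qed
  have wXw: "w \<bullet> (X *v w) = Z $ k $ k"
  proof -
    have "transpose Q *v w = axis k 1"
      unfolding Qw[symmetric] matrix_vector_mul_assoc QQ(2) by simp
    then have "w \<bullet> (X *v w) = axis k 1 \<bullet> (Z *v axis k 1)"
      unfolding Zk(1) by (metis iso)
    then show ?thesis
      by (simp add: inner_axis' matrix_vector_mult_basis column_def)
  qed
  have ZZ: "Z \<bullet> Z = (\<Sum>i\<in>UNIV. \<Sum>j\<in>UNIV. (Z $ i $ j)\<^sup>2)"
    by (simp add: inner_vec_def power2_eq_square)
  have tZ: "trace (Z ** Z) = (\<Sum>i\<in>UNIV. \<Sum>j\<in>UNIV. Z $ i $ j * Z $ j $ i)" "trace Z = (\<Sum>i\<in>UNIV. Z $ i $ i)"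
    by (simp_all add: trace_def matrix_matrix_mult_def)
  show ?thesis
    unfolding t2 t1 bb wXw ZZ tZ
    by (rule pointwise_form_nonneg_coordinates[OF n mu N k2 s D])
qed


section \<open>Choice of the weight of the null Lagrangian\<close>

text \<open>
  The weight is \<open>s = mu * \<kappa>\<close> with \<open>\<kappa> = L / (max mu (L + mu) + \<epsilon>)\<close>:
  its size is the largest that the bound on \<open>s\<^sup>2\<close> permits for the smallest admissible
  \<open>k2\<close>, and its sign makes \<open>L - s\<close> small. After division by \<open>\<kappa>\<^sup>2\<close>
  the last inequality is strict for \<open>\<epsilon> = 0\<close>, and this leaves room for a positive
  \<open>\<epsilon>\<close>. If \<open>L > 0\<close>, that is seen by continuity; if \<open>L \<le> 0\<close>, then
  \<open>L - s = \<kappa> * \<epsilon>\<close> vanishes with \<open>\<epsilon>\<close>, and \<open>\<epsilon>\<close>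
  can be given explicitly.
\<close>

lemma null_lagrangian_weight_exists:
  fixes L mu m :: real
  assumes mu: "0 < mu" and N: "0 < L + mu" and m: "1 \<le> m"
  shows "\<exists>\<epsilon>>0. \<forall>k2>0. (L / (max mu (L + mu) + \<epsilon>))\<^sup>2 \<le> k2 \<longrightarrow>
    (\<exists>s. \<bar>s\<bar> \<le> mu \<and> s\<^sup>2 \<le> mu\<^sup>2 * k2 \<and> 0 \<le> (mu + s) / m + (L - s) \<and>
      (L - s)\<^sup>2 \<le> (L + mu) * k2 * ((mu + s) / m + (L - s)))"
proof -
  define N where "N = L + mu"
  have N0: "0 < N" using N by (simp add: N_def)
  \<comment> \<open>If \<open>L - s = \<kappa> * r\<close>, then \<open>\<kappa>\<^sup>2\<close> cancels and a condition without \<open>k2\<close> remains.\<close>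
  have weight: "\<exists>s. \<bar>s\<bar> \<le> mu \<and> s\<^sup>2 \<le> mu\<^sup>2 * k2 \<and> 0 \<le> (mu + s) / m + (L - s) \<and>
      (L - s)\<^sup>2 \<le> N * k2 * ((mu + s) / m + (L - s))"
    if k: "\<bar>\<kappa>\<bar> \<le> 1" "\<kappa>\<^sup>2 \<le> k2" and \<sigma>: "L - mu * \<kappa> = \<kappa> * r"
      and r: "0 \<le> N / m + \<kappa> * r * (1 - 1 / m)" "r\<^sup>2 \<le> N * (N / m + \<kappa> * r * (1 - 1 / m))"
    for \<kappa> r k2
  proof (intro exI conjI)
    let ?D = "N / m + \<kappa> * r * (1 - 1 / m)"
    have "mu + mu * \<kappa> = N - \<kappa> * r"
      using \<sigma> by (simp add: N_def)
    then have D: "(mu + mu * \<kappa>) / m + (L - mu * \<kappa>) = ?D"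
      using m unfolding \<sigma> by (simp add: field_simps)
    show "\<bar>mu * \<kappa>\<bar> \<le> mu"
      using k(1) mu by (simp add: abs_mult mult_left_le)
    show "(mu * \<kappa>)\<^sup>2 \<le> mu\<^sup>2 * k2"
      using k(2) by (simp add: power_mult_distrib mult_left_mono)
    show "0 \<le> (mu + mu * \<kappa>) / m + (L - mu * \<kappa>)"
      unfolding D by (rule r(1))
    have "(\<kappa> * r)\<^sup>2 \<le> k2 * (N * ?D)"
      unfolding power_mult_distrib using k(2) r order_trans[OF zero_le_power2 k(2)] by (intro mult_mono) auto
    then show "(L - mu * \<kappa>)\<^sup>2 \<le> N * k2 * ((mu + mu * \<kappa>) / m + (L - mu * \<kappa>))"
      unfolding D unfolding \<sigma> by (simp add: mult_ac)
  qed
  have "\<exists>\<epsilon>>0. \<exists>\<kappa> r. \<kappa> * (max mu N + \<epsilon>) = L \<and> \<bar>\<kappa>\<bar> \<le> 1 \<and> L - mu * \<kappa> = \<kappa> * r \<and>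
      0 \<le> N / m + \<kappa> * r * (1 - 1 / m) \<and> r\<^sup>2 \<le> N * (N / m + \<kappa> * r * (1 - 1 / m))"
  proof (cases "0 < L")
    case False
    define \<epsilon> where "\<epsilon> = N / (2 * m)"
    have e: "0 < \<epsilon>" using N0 m by (simp add: \<epsilon>_def)
    define \<kappa> where "\<kappa> = L / (mu + \<epsilon>)"
    have M: "max mu N = mu" using False by (simp add: N_def)
    have pos: "0 < mu + \<epsilon>" using mu e by simp
    have eq: "\<kappa> * (mu + \<epsilon>) = L" using pos by (simp add: \<kappa>_def)
    have k: "- 1 \<le> \<kappa>" "\<kappa> \<le> 0"
      using False N e pos by (simp_all add: \<kappa>_def field_simps)
    have m1: "0 \<le> 1 - 1 / m" "1 - 1 / m \<le> 1" using m by (simp_all add: field_simps)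
    have "(- \<kappa>) * (1 - 1 / m) \<le> 1 * 1" using k m1 by (intro mult_mono) auto
    then have "(- \<kappa> * (1 - 1 / m)) * \<epsilon> \<le> 1 * \<epsilon>" using e by (intro mult_right_mono) auto
    then have b: "- \<epsilon> \<le> \<kappa> * \<epsilon> * (1 - 1 / m)" by (simp add: mult_ac)
    have Nm: "N / m = 2 * \<epsilon>" using m by (simp add: \<epsilon>_def)
    then have c: "\<epsilon> \<le> N / m + \<kappa> * \<epsilon> * (1 - 1 / m)" using b by linarith
    have "\<epsilon> * 1 \<le> \<epsilon> * m" using e m by (intro mult_left_mono) auto
    moreover have "\<epsilon> * m = N / 2" using m by (simp add: \<epsilon>_def)
    ultimately have eN: "\<epsilon> \<le> N" using N0 by linarith
    have "\<epsilon>\<^sup>2 \<le> N * (N / m + \<kappa> * \<epsilon> * (1 - 1 / m))"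
      unfolding power2_eq_square using c eN e N0 by (intro mult_mono) auto
    moreover have "L - mu * \<kappa> = \<kappa> * \<epsilon>" using eq by (simp add: algebra_simps)
    ultimately show ?thesis
      using e k c eq by (intro exI[of _ \<epsilon>] conjI exI[of _ \<kappa>] exI[of _ \<epsilon>]) (auto simp: M)
  next
    case True
    have M: "max mu N = N" using True by (simp add: N_def)
    define F where "F e = N * (N / m + L / (N + e) * (L + e) * (1 - 1 / m)) - (L + e)\<^sup>2" for e
    have LN: "L < N" using mu by (simp add: N_def)
    \<comment> \<open>At \<open>\<epsilon> = 0\<close> the inequality amounts to \<open>L < N\<close>.\<close>
    have F0: "0 < F 0"
    proof -
      have "F 0 = (N\<^sup>2 - L\<^sup>2) / m"
        using N0 m by (simp add: F_def power2_eq_square field_simps)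
      moreover have "L\<^sup>2 < N\<^sup>2" using True LN by (intro power_strict_mono) auto
      ultimately show ?thesis using m by simp
    qed
    have "isCont F 0"
      unfolding F_def using N0 by (intro continuous_intros) auto
    then have "(F \<longlongrightarrow> F 0) (at_right 0)"
      by (simp add: isCont_def filterlim_at_split)
    then have "eventually (\<lambda>e. 0 < F e) (at_right 0)"
      by (rule order_tendstoD(1)[OF _ F0])
    then have "eventually (\<lambda>e. 0 < F e \<and> 0 < e) (at_right 0)"
      by (intro eventually_conj eventually_at_right_less)
    then obtain \<epsilon> where e: "0 < F \<epsilon>" "0 < \<epsilon>"
      using eventually_happens[of "\<lambda>e. 0 < F e \<and> 0 < e" "at_right 0"] trivial_limit_at_right_real[of 0]
      by blast
    define \<kappa> where "\<kappa> = L / (N + \<epsilon>)"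
    have pos: "0 < N + \<epsilon>" using N0 e by simp
    have eq: "\<kappa> * (N + \<epsilon>) = L" using pos by (simp add: \<kappa>_def)
    have k: "0 \<le> \<kappa>" "\<kappa> \<le> 1"
      using True LN e pos by (simp_all add: \<kappa>_def)
    have m1: "0 \<le> 1 - 1 / m" using m by (simp add: field_simps)
    have "0 \<le> \<kappa> * (L + \<epsilon>) * (1 - 1 / m)" using k True e m1 by (intro mult_nonneg_nonneg) auto
    then have "0 \<le> N / m + \<kappa> * (L + \<epsilon>) * (1 - 1 / m)" using N0 m by simp
    moreover have "(L + \<epsilon>)\<^sup>2 \<le> N * (N / m + \<kappa> * (L + \<epsilon>) * (1 - 1 / m))"
      using e(1) by (simp add: F_def \<kappa>_def)
    moreover have "L - mu * \<kappa> = \<kappa> * (L + \<epsilon>)"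
      using eq by (simp add: N_def algebra_simps)
    ultimately show ?thesis
      using e k eq by (intro exI[of _ \<epsilon>] conjI exI[of _ \<kappa>] exI[of _ "L + \<epsilon>"]) (auto simp: M)
  qed
  then obtain \<epsilon> \<kappa> r where e: "0 < \<epsilon>" and eq: "\<kappa> * (max mu N + \<epsilon>) = L" and k: "\<bar>\<kappa>\<bar> \<le> 1"
    and r: "L - mu * \<kappa> = \<kappa> * r" "0 \<le> N / m + \<kappa> * r * (1 - 1 / m)"
      "r\<^sup>2 \<le> N * (N / m + \<kappa> * r * (1 - 1 / m))"
    by blast
  have "max mu N + \<epsilon> \<noteq> 0" using mu e by linarith
  then have "L / (max mu N + \<epsilon>) = \<kappa>" using eq by (simp add: divide_eq_eq)
  then show ?thesis
    unfolding N_def[symmetric] using e weight[OF k _ r] by auto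
qed

section \<open>Dissipativity\<close>

text \<open>
  Subtracting \<open>(mu - s) * minors_form X X\<close> turns the coefficients of \<open>(trace X)\<^sup>2\<close> and
  \<open>trace (X ** X)\<close> into \<open>lam + mu - s\<close> and \<open>s\<close>. Where \<open>v = 0\<close> the
  radial part is \<open>0\<close>, and the pointwise inequality is used with \<open>k2 = 1\<close> and an arbitrary
  unit vector.
\<close>

lemma dissipativity_integrand_ge:
  fixes X :: "real ^ 'n::finite ^ 'n" and v :: "real ^ 'n"
  assumes n: "CARD('n) \<ge> 2" and mu: "0 < mu" and N: "0 < lam + 2 * mu" and k2: "0 < 1 - g\<^sup>2"
    and s: "\<bar>s\<bar> \<le> mu" "s\<^sup>2 \<le> mu\<^sup>2 * (1 - g\<^sup>2)"
    and D0: "0 \<le> (mu + s) / (real CARD('n) - 1) + (lam + mu - s)"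
    and D: "(lam + mu - s)\<^sup>2 \<le> (lam + mu + mu) * (1 - g\<^sup>2) * ((mu + s) / (real CARD('n) - 1) + (lam + mu - s))"
  defines "w \<equiv> v /\<^sub>R norm v"
  shows "(mu - s) * minors_form X X \<le>
    coeff_form (lame_coeff lam mu) (X - g *\<^sub>R outer_product w (transpose X *v w)) (X + g *\<^sub>R outer_product w (transpose X *v w))"
proof (cases "v = 0")
  case False
  then have w: "norm w = 1" by (simp add: w_def)
  then have ww: "w \<bullet> w = 1" by (simp add: norm_eq_1)
  have N': "0 < lam + mu + mu" using N by simp
  show ?thesis
    using pointwise_form_nonneg[OF n mu N' k2 s D w, of X]
    unfolding coeff_form_lame_radial minors_form_self ww by (simp add: algebra_simps)
next
  case True
  obtain u :: "real ^ 'n" where u: "norm u = 1"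
    using vector_choose_size[of 1] by auto
  have N': "0 < lam + mu + mu" using N by simp
  have g: "0 \<le> g\<^sup>2" by simp
  have s1: "s\<^sup>2 \<le> mu\<^sup>2 * 1"
    using s(1) mu by (simp add: abs_le_square_iff[symmetric])
  have "(lam + mu + mu) * (1 - g\<^sup>2) * ((mu + s) / (real CARD('n) - 1) + (lam + mu - s))
      \<le> (lam + mu + mu) * 1 * ((mu + s) / (real CARD('n) - 1) + (lam + mu - s))"
    using N' D0 by (intro mult_right_mono mult_left_mono) auto
  with D have D1: "(lam + mu - s)\<^sup>2 \<le> (lam + mu + mu) * 1 * ((mu + s) / (real CARD('n) - 1) + (lam + mu - s))"
    by linarith
  have "w = 0" using True by (simp add: w_def)
  then show ?thesis
    using pointwise_form_nonneg[OF n mu N' zero_less_one s(1) s1 D1 u, of X]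
    unfolding coeff_form_lame_radial minors_form_self by (simp add: algebra_simps)
qed

lemma radial_part_AE_eq:
  fixes v :: "real ^ 'n::finite \<Rightarrow> real ^ 'n"
  assumes \<Omega>: "open \<Omega>" and v: "v \<in> W12_0 \<Omega>"
  shows "AE x in lebesgue_on \<Omega>. radial_part \<Omega> v x =
    outer_product (v x /\<^sub>R norm (v x)) (transpose (weak_jacobian \<Omega> v x) *v (v x /\<^sub>R norm (v x)))"
  using weak_grad_AE_eq[OF \<Omega> W12_0_norm_weak_grad[OF \<Omega> v]]
proof eventually_elim
  case (elim x)
  define w where "w = v x /\<^sub>R norm (v x)"
  have w: "v x $ \<alpha> / norm (v x) = w $ \<alpha>" for \<alpha>
    by (simp add: w_def divide_inverse mult.commute)
  have "w \<bullet> column h X = (transpose X *v w) $ h" for X :: "real ^ 'n ^ 'n" and h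
    unfolding column_def transpose_def matrix_vector_mult_def inner_vec_def
    by (simp add: mult.commute)
  then show ?case
    unfolding radial_part_def elim outer_product_def w_def[symmetric] w vec_lambda_beta by simp
qed

text \<open>
  The null Lagrangian has integral \<open>0\<close>, so subtracting a multiple of it leaves the integral unchanged and
  makes the integrand nonnegative. If the integrand failed to be integrable, its integral would be \<open>0\<close> by
  convention.
\<close>

lemma Lp_dissipative_lame:
  fixes \<Omega> :: "(real ^ 'n::finite) set"
  assumes \<Omega>: "open \<Omega>" and n: "CARD('n) \<ge> 2" and mu: "0 < mu" and N: "0 < lam + 2 * mu"
    and k2: "0 < 1 - (1 - 2 / p)\<^sup>2"
    and s: "\<bar>s\<bar> \<le> mu" "s\<^sup>2 \<le> mu\<^sup>2 * (1 - (1 - 2 / p)\<^sup>2)"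
    and D0: "0 \<le> (mu + s) / (real CARD('n) - 1) + (lam + mu - s)"
    and D: "(lam + mu - s)\<^sup>2 \<le> (lam + mu + mu) * (1 - (1 - 2 / p)\<^sup>2) * ((mu + s) / (real CARD('n) - 1) + (lam + mu - s))"
  shows "Lp_dissipative \<Omega> (lame_coeff lam mu) p"
  unfolding Lp_dissipative_def
proof
  fix v :: "real ^ 'n \<Rightarrow> real ^ 'n" assume v: "v \<in> W12_0 \<Omega>"
  let ?M = "lebesgue_on \<Omega>" and ?G = "weak_jacobian \<Omega> v"
  define E where "E x = coeff_form (lame_coeff lam mu)
      (?G x - (1 - 2 / p) *\<^sub>R radial_part \<Omega> v x) (?G x + (1 - 2 / p) *\<^sub>R radial_part \<Omega> v x)" for x
  note nl = integral_minors_form_eq_0[OF \<Omega> v]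
  have ge: "AE x in ?M. 0 \<le> E x - (mu - s) * minors_form (?G x) (?G x)"
    using radial_part_AE_eq[OF \<Omega> v]
  proof eventually_elim
    case (elim x)
    show ?case
      using dissipativity_integrand_ge[OF n mu N k2 s D0 D, of "?G x" "v x"]
      by (simp add: E_def elim)
  qed
  have "0 \<le> (LINT x|?M. E x)"
  proof (cases "integrable ?M E")
    case True
    have "0 \<le> (LINT x|?M. E x - (mu - s) * minors_form (?G x) (?G x))"
      by (rule integral_nonneg_AE[OF ge])
    also have "\<dots> = (LINT x|?M. E x) - (mu - s) * (LINT x|?M. minors_form (?G x) (?G x))"
      using True nl(1) by simp
    finally show ?thesis by (simp add: nl(2))
  qed (simp add: not_integrable_integral_eq)
  then show "0 \<le> (LINT x|?M. coeff_form (lame_coeff lam mu)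
      (?G x - (1 - 2 / p) *\<^sub>R radial_part \<Omega> v x) (?G x + (1 - 2 / p) *\<^sub>R radial_part \<Omega> v x))"
    by (simp add: E_def)
qed

theorem theorem1p3:
  fixes lam mu :: real
  assumes "CARD('n::finite) \<ge> 2" and "mu > 0" and "lam + 2 * mu > 0"
  shows "\<exists>\<epsilon>>0.
    (\<forall>(\<Omega> :: (real ^ 'n) set) p.
       open \<Omega> \<and> connected \<Omega> \<and> \<Omega> \<noteq> {} \<and> 1 < p \<and>
       (1 - 2 / p)\<^sup>2 \<le> 1 - ((lam + mu) / (max mu (lam + 2 * mu) + \<epsilon>))\<^sup>2
       \<longrightarrow> Lp_dissipative \<Omega> (lame_coeff lam mu) p) \<and>
    (CARD('n) \<ge> 3 \<longrightarrow>
       {p. 1 < p \<and> (1 - 2 / p)\<^sup>2 \<le> 1 - \<bar>lam + mu\<bar> / max mu (lam + 2 * mu)}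
       \<subseteq> {p. 1 < p \<and> (1 - 2 / p)\<^sup>2 \<le> 1 - ((lam + mu) / (max mu (lam + 2 * mu) + \<epsilon>))\<^sup>2})"
proof -
  define M where "M = max mu (lam + 2 * mu)"
  have N: "0 < (lam + mu) + mu" using assms(3) by simp
  have Neq: "lam + mu + mu = lam + 2 * mu" by simp
  have m: "1 \<le> real CARD('n) - 1" using assms(1) by simp
  obtain \<epsilon> where e: "0 < \<epsilon>" and weight: "\<And>k2. 0 < k2 \<Longrightarrow> ((lam + mu) / (M + \<epsilon>))\<^sup>2 \<le> k2 \<Longrightarrow>
      \<exists>s. \<bar>s\<bar> \<le> mu \<and> s\<^sup>2 \<le> mu\<^sup>2 * k2 \<and> 0 \<le> (mu + s) / (real CARD('n) - 1) + (lam + mu - s) \<and>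
        (lam + mu - s)\<^sup>2 \<le> (lam + mu + mu) * k2 * ((mu + s) / (real CARD('n) - 1) + (lam + mu - s))"
    using null_lagrangian_weight_exists[OF assms(2) N m] unfolding M_def Neq by blast
  have M: "0 < M" "\<bar>lam + mu\<bar> \<le> M"
    using assms(2,3) by (auto simp: M_def)
  have diss: "Lp_dissipative \<Omega> (lame_coeff lam mu) p"
    if \<Omega>: "open \<Omega>" and p: "1 < p" "(1 - 2 / p)\<^sup>2 \<le> 1 - ((lam + mu) / (M + \<epsilon>))\<^sup>2"
    for \<Omega> :: "(real ^ 'n) set" and p :: real
  proof -
    have "\<bar>1 - 2 / p\<bar> < 1" using p(1) by (simp add: abs_less_iff field_simps)
    then have k2: "0 < 1 - (1 - 2 / p)\<^sup>2"
      by (simp add: abs_square_less_1)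
    have "((lam + mu) / (M + \<epsilon>))\<^sup>2 \<le> 1 - (1 - 2 / p)\<^sup>2" using p(2) by simp
    from weight[OF k2 this] obtain s where
      "\<bar>s\<bar> \<le> mu" "s\<^sup>2 \<le> mu\<^sup>2 * (1 - (1 - 2 / p)\<^sup>2)"
      "0 \<le> (mu + s) / (real CARD('n) - 1) + (lam + mu - s)"
      "(lam + mu - s)\<^sup>2 \<le> (lam + mu + mu) * (1 - (1 - 2 / p)\<^sup>2) * ((mu + s) / (real CARD('n) - 1) + (lam + mu - s))"
      by blast
    then show ?thesis
      by (rule Lp_dissipative_lame[OF \<Omega> assms k2])
  qed
  have "((lam + mu) / (M + \<epsilon>))\<^sup>2 \<le> \<bar>lam + mu\<bar> / M"
  proof -
    have q: "\<bar>(lam + mu) / (M + \<epsilon>)\<bar> \<le> \<bar>lam + mu\<bar> / M"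
      using M e by (simp add: abs_divide frac_le)
    have t: "0 \<le> \<bar>lam + mu\<bar> / M" "\<bar>lam + mu\<bar> / M \<le> 1" using M by simp_all
    have "\<bar>(lam + mu) / (M + \<epsilon>)\<bar> * \<bar>(lam + mu) / (M + \<epsilon>)\<bar> \<le> (\<bar>lam + mu\<bar> / M) * 1"
      by (rule mult_mono[OF q order_trans[OF q t(2)] t(1) abs_ge_zero])
    then show ?thesis by (simp add: power2_eq_square)
  qed
  then have "{p. 1 < p \<and> (1 - 2 / p)\<^sup>2 \<le> 1 - \<bar>lam + mu\<bar> / M}
      \<subseteq> {p. 1 < p \<and> (1 - 2 / p)\<^sup>2 \<le> 1 - ((lam + mu) / (M + \<epsilon>))\<^sup>2}"
    by auto
  with e diss show ?thesis
    unfolding M_def by (intro exI[of _ \<epsilon>]) blast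
qed

end
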